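(* Let $U,J>0$ and consider the periodic nearest-neighbor $d$-dimensional hypercubic lattice of linear size $L$, with $N_s=L^d$ cells. For $0<M<N_s$, let $E_0(\Theta)$ be the ground-state energy, in the sector $N_e=4M$, of the Hamiltonian $H(\Theta)$ with total quartet boundary twist $\Theta$ along one periodic direction, and define $$\rho_4(L,M)=L^{2-d}\left.\frac{\partial^2E_0(\Theta)}{\partial\Theta^2}\right|_{\Theta=0}.$$ Then $$\rho_4(L,M)=J\,\frac{M(N_s-M)}{N_s(N_s-1)},$$ and this converges to $J\nu_4(1-\nu_4)$ in the limit $L\to\infty$ with $M/N_s\to\nu_4$. The limiting stiffness is positive for $0<\nu_4<1$.
   Context: Each cell $\bm R$ of the lattice carries four fermionic modes with creation operators $c_{\bm R,m}^\dagger$, $m=1,\dots,4$, and number operators $\hat n_{\bm R,m}=c_{\bm R,m}^\dagger c_{\bm R,m}$; $N_e=\sum_{\bm R,m}\hat n_{\bm R,m}$. Define $q_{\bm R}^\dagger=c_{\bm R,1}^\dagger c_{\bm R,2}^\dagger c_{\bm R,3}^\dagger c_{\bm R,4}^\dagger$, $q_{\bm R}=(q_{\bm R}^\dagger)^\dagger$, $P_{\bm R}^{(0)}=\prod_m(1-\hat n_{\bm R,m})$, $P_{\bm R}^{(4)}=\prod_m\hat n_{\bm R,m}$, $P_{\bm R}=P_{\bm R}^{(0)}+P_{\bm R}^{(4)}$. The untwisted Hamiltonian is $$H(0)=U\sum_{\bm R}(1-P_{\bm R})+J\sum_{\langle\bm R\bm R'\rangle}h_{\bm R\bm R'},\qquad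 h_{\bm R\bm R'}=\tfrac12\left[P_{\bm R}^{(4)}P_{\bm R'}^{(0)}+P_{\bm R}^{(0)}P_{\bm R'}^{(4)}-q_{\bm R}^\dagger q_{\bm R'}-q_{\bm R'}^\dagger q_{\bm R}\right],$$ the sum being over nearest-neighbor bonds. The twisted Hamiltonian $H(\Theta)$ is obtained from $H(0)$ by replacing the quartet-transfer terms on bonds parallel to the unit vector $\hat x$ of the chosen periodic direction by $$-\frac J2\sum_{\bm R}\left(e^{\mathrm i\Theta/L}q_{\bm R+\hat x}^\dagger q_{\bm R}+\mathrm{H.c.}\right)$$ (uniform gauge), leaving all other terms unchanged. *)

theory Defs
  imports "HOL-Analysis.Analysis" "HOL-Library.Countable" "HOL-Library.Function_Algebras"
begin

section \<open>The periodic hypercubic lattice\<close>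

type_synonym cell = "nat list"

definition cells :: "nat \<Rightarrow> nat \<Rightarrow> cell set" where
  "cells d L = {R. length R = d \<and> set R \<subseteq> {..<L}}"

definition shift :: "nat \<Rightarrow> nat \<Rightarrow> cell \<Rightarrow> cell" where
  "shift L \<mu> R = R[\<mu> := (R ! \<mu> + 1) mod L]"

text \<open>
  A nearest-neighbour bond is given by its lower end \<open>R\<close> and its direction \<open>\<mu>\<close>; it joins
  \<open>R\<close> to \<open>shift L \<mu> R\<close>. For \<open>L \<ge> 3\<close> this lists every unordered pair of neighbours exactly
  once. For \<open>L = 2\<close> the two bonds that wrap around the lattice in opposite ways are counted
  separately, as they also are in a sum over \<open>R\<close> of the terms joining \<open>R\<close> to \<open>R + x\<close>.
\<close>

definition bonds :: "nat \<Rightarrow> nat \<Rightarrow> (cell \<times> nat) set" where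
  "bonds d L = cells d L \<times> {..<d}"

section \<open>Fermionic Fock space\<close>

text \<open>
  A mode is a pair of a cell and a label in \<open>{1..4}\<close>. A state is given by its amplitudes in
  the occupation number basis, whose elements are the sets of occupied modes. The operators
  below act on all amplitude functions; the Fock space of the finite lattice consists of
  those supported on the sets of modes of the lattice.
\<close>

type_synonym mode = "cell \<times> nat"
type_synonym state = "mode set \<Rightarrow> complex"
type_synonym operator = "state \<Rightarrow> state"

definition modes :: "nat \<Rightarrow> nat \<Rightarrow> mode set" where
  "modes d L = cells d L \<times> {1..4}"

definition fock :: "nat \<Rightarrow> nat \<Rightarrow> state set" where
  "fock d L = {\<psi>. \<forall>S. \<psi> S \<noteq> 0 \<longrightarrow> S \<subseteq> modes d L}"

definition fock_inner :: "nat \<Rightarrow> nat \<Rightarrow> state \<Rightarrow> state \<Rightarrow> complex" where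
  "fock_inner d L \<phi> \<psi> = (\<Sum>S\<in>Pow (modes d L). cnj (\<phi> S) * \<psi> S)"

text \<open>
  The Jordan--Wigner signs refer to the order of the modes by \<open>mode_key\<close>. Any other order
  gives a unitarily equivalent representation of the anticommutation relations.
\<close>

definition mode_key :: "mode \<Rightarrow> nat" where
  "mode_key k = 4 * to_nat (fst k) + snd k"

definition jw_sign :: "mode \<Rightarrow> mode set \<Rightarrow> complex" where
  "jw_sign k S = (- 1) ^ card {j \<in> S. mode_key j < mode_key k}"

definition annihilate :: "mode \<Rightarrow> operator" where
  "annihilate k \<psi> = (\<lambda>S. if k \<in> S then 0 else jw_sign k S * \<psi> (insert k S))"

definition create :: "mode \<Rightarrow> operator" where
  "create k \<psi> = (\<lambda>S. if k \<in> S then jw_sign k S * \<psi> (S - {k}) else 0)"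

text \<open>
  Sums and differences of operators are the pointwise ones, products are compositions, and
  the identity operator is \<open>id\<close> (the pointwise \<open>1\<close> and \<open>*\<close> on functions are not used).
\<close>

definition op_scale :: "complex \<Rightarrow> operator \<Rightarrow> operator"  (infixr \<open>*\<^sub>o\<close> 75) where
  "a *\<^sub>o A = (\<lambda>\<psi> S. a * A \<psi> S)"

section \<open>Quartet operators and Hamiltonians\<close>

definition num :: "cell \<Rightarrow> nat \<Rightarrow> operator" where
  "num R m = create (R, m) \<circ> annihilate (R, m)"

definition total_num :: "nat \<Rightarrow> nat \<Rightarrow> operator" where
  "total_num d L = (\<Sum>R\<in>cells d L. \<Sum>m\<in>{1..4}. num R m)"

definition quartet_create :: "cell \<Rightarrow> operator" where
  "quartet_create R = create (R, 1) \<circ> create (R, 2) \<circ> create (R, 3) \<circ> create (R, 4)"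

definition quartet_annihilate :: "cell \<Rightarrow> operator" where
  "quartet_annihilate R =
     annihilate (R, 4) \<circ> annihilate (R, 3) \<circ> annihilate (R, 2) \<circ> annihilate (R, 1)"

definition proj_empty :: "cell \<Rightarrow> operator" where
  "proj_empty R = (id - num R 1) \<circ> (id - num R 2) \<circ> (id - num R 3) \<circ> (id - num R 4)"

definition proj_full :: "cell \<Rightarrow> operator" where
  "proj_full R = num R 1 \<circ> num R 2 \<circ> num R 3 \<circ> num R 4"

definition proj_quartet :: "cell \<Rightarrow> operator" where
  "proj_quartet R = proj_empty R + proj_full R"

definition bond_term :: "cell \<Rightarrow> cell \<Rightarrow> operator" where
  "bond_term R R' = (1/2) *\<^sub>o
     ((proj_full R \<circ> proj_empty R') + (proj_empty R \<circ> proj_full R')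
      - (quartet_create R \<circ> quartet_annihilate R')
      - (quartet_create R' \<circ> quartet_annihilate R))"

definition H_untwisted :: "nat \<Rightarrow> nat \<Rightarrow> real \<Rightarrow> real \<Rightarrow> operator" where
  "H_untwisted d L U J =
     complex_of_real U *\<^sub>o (\<Sum>R\<in>cells d L. id - proj_quartet R)
     + complex_of_real J *\<^sub>o (\<Sum>(R, \<mu>)\<in>bonds d L. bond_term R (shift L \<mu> R))"

text \<open>
  The quartet transfer along direction \<open>a\<close> when each forward hop carries the phase \<open>\<theta>\<close>; the
  second summand is the Hermitian conjugate of the first.
\<close>

definition transfer :: "nat \<Rightarrow> nat \<Rightarrow> nat \<Rightarrow> real \<Rightarrow> real \<Rightarrow> operator" where
  "transfer d L a J \<theta> = complex_of_real (- J / 2) *\<^sub>o (\<Sum>R\<in>cells d L.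
     cis \<theta> *\<^sub>o (quartet_create (shift L a R) \<circ> quartet_annihilate R)
     + cis (- \<theta>) *\<^sub>o (quartet_create R \<circ> quartet_annihilate (shift L a R)))"

text \<open>The transfer terms of \<open>H_untwisted\<close> along \<open>a\<close> are \<open>transfer d L a J 0\<close>.\<close>

definition H_twisted :: "nat \<Rightarrow> nat \<Rightarrow> nat \<Rightarrow> real \<Rightarrow> real \<Rightarrow> real \<Rightarrow> operator" where
  "H_twisted d L a U J \<Theta> =
     H_untwisted d L U J - transfer d L a J 0 + transfer d L a J (\<Theta> / real L)"

section \<open>Ground-state energy and stiffness\<close>

definition sector :: "nat \<Rightarrow> nat \<Rightarrow> nat \<Rightarrow> state set" where
  "sector d L n = {\<psi> \<in> fock d L. total_num d L \<psi> = (\<lambda>S. of_nat n * \<psi> S)}"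

definition energy_level :: "operator \<Rightarrow> state set \<Rightarrow> real \<Rightarrow> bool" where
  "energy_level H V E \<longleftrightarrow>
     (\<exists>\<psi>\<in>V. \<psi> \<noteq> (\<lambda>S. 0) \<and> H \<psi> = (\<lambda>S. complex_of_real E * \<psi> S))"

definition E0 :: "nat \<Rightarrow> nat \<Rightarrow> nat \<Rightarrow> real \<Rightarrow> real \<Rightarrow> nat \<Rightarrow> real \<Rightarrow> real" where
  "E0 d L a U J M \<Theta> = (LEAST E. energy_level (H_twisted d L a U J \<Theta>) (sector d L (4 * M)) E)"

definition rho4 :: "nat \<Rightarrow> nat \<Rightarrow> real \<Rightarrow> real \<Rightarrow> nat \<Rightarrow> nat \<Rightarrow> real" where
  "rho4 d a U J L M = real L powi (2 - int d) * deriv (deriv (E0 d L a U J M)) 0"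

section \<open>Consistency of the conventions\<close>

lemma finite_modes: "finite (modes d L)"
proof -
  have "cells d L = {R. set R \<subseteq> {..<L} \<and> length R = d}"
    by (auto simp: cells_def)
  then show ?thesis
    by (simp add: modes_def finite_lists_length_eq)
qed

lemma card_cells: "card (cells d L) = L ^ d"
proof -
  have "cells d L = {R. set R \<subseteq> {..<L} \<and> length R = d}"
    by (auto simp: cells_def)
  then show ?thesis
    by (simp add: card_lists_length_eq)
qed

lemma H_twisted_0: "H_twisted d L a U J 0 = H_untwisted d L U J"
  by (simp add: H_twisted_def)

lemma bonds_unordered_pairs:
  assumes "L \<ge> 3"
  shows "inj_on (\<lambda>(R, \<mu>). {R, shift L \<mu> R}) (bonds d L)"
proof (rule inj_onI, clarsimp simp: bonds_def)
  fix R \<mu> R' \<nu>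
  assume R: "R \<in> cells d L" "\<mu> < d" and R': "R' \<in> cells d L" "\<nu> < d"
    and eq: "{R, shift L \<mu> R} = {R', shift L \<nu> R'}"
  have len: "length R = d" "length R' = d"
    using R R' by (auto simp: cells_def)
  have nth_less: "S ! i < L" if "S \<in> cells d L" "i < d" for S i
    using that by (auto simp: cells_def subset_iff)
  have bound: "R ! i < L" "R' ! i < L" if "i < d" for i
    using nth_less[OF R(1) that] nth_less[OF R'(1) that] .
  have step: "(x + 1) mod L \<noteq> x" if "x < L" for x
    using assms that by (cases "x + 1 = L") auto
  have step2: "((x + 1) mod L + 1) mod L \<noteq> x" if "x < L" for x
    using assms that by (cases "x + 1 = L"; cases "x + 2 = L") auto
  have self: "shift L \<kappa> S ! \<kappa> = (S ! \<kappa> + 1) mod L" if "\<kappa> < d" "length S = d" for \<kappa> S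
    using that by (simp add: shift_def)
  have other: "shift L \<kappa> S ! i = S ! i" if "\<kappa> \<noteq> i" for \<kappa> i S
    using that by (simp add: shift_def)
  have len_shift: "length (shift L \<kappa> S) = length S" for \<kappa> S
    by (simp add: shift_def)
  have "R = R' \<and> shift L \<mu> R = shift L \<nu> R' \<or> R = shift L \<nu> R' \<and> shift L \<mu> R = R'"
    using eq unfolding doubleton_eq_iff by blast
  then show "R = R' \<and> \<mu> = \<nu>"
  proof
    assume *: "R = R' \<and> shift L \<mu> R = shift L \<nu> R'"
    have "\<mu> = \<nu>"
    proof (rule ccontr)
      assume "\<mu> \<noteq> \<nu>"
      then have "(R ! \<mu> + 1) mod L = R ! \<mu>"
        using * self[OF R(2) len(1)] other[of \<nu> \<mu> R] by metis
      then show False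
        using step[OF bound(1)[OF R(2)]] by blast
    qed
    with * show ?thesis by blast
  next
    assume *: "R = shift L \<nu> R' \<and> shift L \<mu> R = R'"
    then have two: "shift L \<mu> (shift L \<nu> R') ! \<nu> = R' ! \<nu>" by metis
    have one: "shift L \<nu> R' ! \<nu> = (R' ! \<nu> + 1) mod L"
      by (rule self[OF R'(2) len(2)])
    have False
    proof (cases "\<mu> = \<nu>")
      case True
      then show False
        using two one self[OF R'(2), of "shift L \<nu> R'"] len_shift[of \<nu> R'] len(2)
          step2[OF bound(2)[OF R'(2)]] by metis
    next
      case False
      then show False
        using two one other step[OF bound(2)[OF R'(2)]] by metis
    qed
    then show ?thesis ..
  qed
qed

lemma mode_key_inj: "inj_on mode_key (UNIV \<times> {1..4})"
proof (rule inj_onI, clarsimp simp: mode_key_def)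
  fix R R' :: cell and m m' :: nat
  assume "Suc 0 \<le> m" "m \<le> 4" "Suc 0 \<le> m'" "m' \<le> 4" "4 * to_nat R + m = 4 * to_nat R' + m'"
  then have "to_nat R = to_nat R' \<and> m = m'" by presburger
  then show "R = R' \<and> m = m'" by simp
qed

lemma jw_sign_insert:
  assumes "finite S" "j \<notin> S"
  shows "jw_sign k (insert j S) = (if mode_key j < mode_key k then - jw_sign k S else jw_sign k S)"
proof -
  have "{i \<in> insert j S. mode_key i < mode_key k} =
      (if mode_key j < mode_key k then insert j {i \<in> S. mode_key i < mode_key k}
       else {i \<in> S. mode_key i < mode_key k})"
    by auto
  then show ?thesis
    using assms by (simp add: jw_sign_def)
qed

lemma jw_sign_square [simp]: "jw_sign k S * jw_sign k S = 1"
  by (simp add: jw_sign_def flip: power_add)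

lemma jw_sign_square' [simp]: "jw_sign k S * (jw_sign k S * x) = x"
  by (simp flip: mult.assoc)

lemma jw_sign_insert_self [simp]: "jw_sign k (insert k S) = jw_sign k S"
proof -
  have "{i \<in> insert k S. mode_key i < mode_key k} = {i \<in> S. mode_key i < mode_key k}"
    by auto
  then show ?thesis by (simp add: jw_sign_def)
qed

lemma jw_sign_remove_self [simp]: "jw_sign k (S - {k}) = jw_sign k S"
  using jw_sign_insert_self[of k "S - {k}"] jw_sign_insert_self[of k S] by simp

lemma cnj_jw_sign [simp]: "cnj (jw_sign k S) = jw_sign k S"
  by (simp add: jw_sign_def)

lemma anticommute_annihilate_create:
  assumes "j \<in> UNIV \<times> {1..4}" "k \<in> UNIV \<times> {1..4}" "finite S"
  shows "(annihilate j (create k \<psi>) + create k (annihilate j \<psi>)) S = (if j = k then \<psi> S else 0)"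
proof (cases "j = k")
  case True
  then show ?thesis
    by (auto simp: annihilate_def create_def insert_absorb)
next
  case False
  then have key: "mode_key j \<noteq> mode_key k"
    using mode_key_inj assms by (auto dest: inj_onD)
  show ?thesis
  proof (cases "k \<in> S \<and> j \<notin> S")
    case True
    define T where "T = S - {k}"
    have S: "S = insert k T" and T: "finite T" "k \<notin> T" "j \<notin> T"
      using True assms by (auto simp: T_def)
    have "insert j S - {k} = insert j T" "S - {k} = T"
      using S T False by auto
    then show ?thesis
      using True False T key S
      by (auto simp: annihilate_def create_def jw_sign_insert)
  qed (use False in \<open>auto simp: annihilate_def create_def\<close>)
qed

lemma anticommute_annihilate:
  assumes "j \<in> UNIV \<times> {1..4}" "k \<in> UNIV \<times> {1..4}" "finite S"
  shows "(annihilate j (annihilate k \<psi>) + annihilate k (annihilate j \<psi>)) S = 0"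
proof (cases "j = k")
  case True
  then show ?thesis
    by (auto simp: annihilate_def)
next
  case False
  then have "mode_key j \<noteq> mode_key k"
    using mode_key_inj assms by (auto dest: inj_onD)
  then show ?thesis
    using False assms by (auto simp: annihilate_def jw_sign_insert insert_commute)
qed

lemma create_adjoint:
  assumes "k \<in> modes d L"
  shows "fock_inner d L (create k \<phi>) \<psi> = fock_inner d L \<phi> (annihilate k \<psi>)"
proof -
  let ?P = "Pow (modes d L)"
  have fin: "finite ?P" by (simp add: finite_modes)
  have "fock_inner d L (create k \<phi>) \<psi> =
      (\<Sum>S\<in>{S \<in> ?P. k \<in> S}. cnj (jw_sign k S * \<phi> (S - {k})) * \<psi> S)"
    unfolding fock_inner_def create_def
    by (rule sum.mono_neutral_cong_right) (use fin in auto)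
  also have "\<dots> = (\<Sum>S\<in>{S \<in> ?P. k \<notin> S}. cnj (\<phi> S) * (jw_sign k S * \<psi> (insert k S)))"
    by (rule sum.reindex_bij_witness[where i = "insert k" and j = "\<lambda>S. S - {k}"])
      (use assms in \<open>auto simp: insert_absorb\<close>)
  also have "\<dots> = fock_inner d L \<phi> (annihilate k \<psi>)"
    unfolding fock_inner_def annihilate_def
    by (rule sum.mono_neutral_cong_left) (use fin in auto)
  finally show ?thesis .
qed

lemma quartet_create_adjoint:
  assumes "R \<in> cells d L"
  shows "fock_inner d L (quartet_create R \<phi>) \<psi> = fock_inner d L \<phi> (quartet_annihilate R \<psi>)"
  using assms by (simp add: quartet_create_def quartet_annihilate_def create_adjoint modes_def)

end

theory Submission
  imports Defs
begin

text \<open>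
  In the occupation basis a quartet operator acts without sign, so in the sector \<open>N\<^sub>e = 4 M\<close> the
  quadratic form of \<open>H(0)\<close> is \<open>U\<close> times the number of broken cells plus \<open>J / 2\<close> times the squared
  differences of the amplitudes across quartet hops. Its zeros are the amplitudes that vanish on
  configurations with broken cells and are constant on the others, because the transpositions of
  neighbouring cells connect all choices of \<open>M\<close> cells. So \<open>0\<close> is a simple lowest eigenvalue with the
  uniform vector \<open>e\<close> as eigenvector, and it stays simple for small \<open>\<Theta>\<close>. The first derivative of
  \<open>H(\<Theta>)\<close> at \<open>0\<close> annihilates \<open>e\<close>, so second-order perturbation theory reduces to the diamagnetic
  term \<open>\<langle>e, H''(0) e\<rangle> / \<langle>e, e\<rangle>\<close>, which counts the choices of \<open>M\<close> cells that separate two given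
  neighbours.
\<close>

section \<open>Hermitian kernels on a finite set\<close>

text \<open>\<open>E0\<close> is a \<open>LEAST\<close> over a set of reals and \<open>deriv\<close>
  is total, so attainment of the minimum and differentiability both have to be proved. Attainment is
  variational: a minimiser of the Rayleigh quotient exists by compactness and is an eigenvector.
  Textbook perturbation theory would differentiate the ground state and sum over excited states.
  Here a Lipschitz bound on the ground state is enough: it follows from the gap, and the exact
  vanishing of the first-order term on \<open>e\<close> does the rest. That vanishing depends on the
  uniform gauge: the currents cancel only when every bond of a ring carries the same phase, and they
  would not cancel if the whole twist sat on one cut. The gap may depend on \<open>L\<close> and
  \<open>M\<close>, because only a fixed finite lattice is differentiated; the result is exact there
  and the limit is taken afterwards. With N = \<open>L ^ d\<close>, the N bonds along the twist give
  a second derivative of J / L^2 times N times the ratio of the binomials (N-2 over M-1) and (N over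
  M).\<close>

definition inner_on :: "'a set \<Rightarrow> ('a \<Rightarrow> complex) \<Rightarrow> ('a \<Rightarrow> complex) \<Rightarrow> complex" where
  "inner_on X \<phi> \<psi> = (\<Sum>S\<in>X. cnj (\<phi> S) * \<psi> S)"

definition norm_on :: "'a set \<Rightarrow> ('a \<Rightarrow> complex) \<Rightarrow> real" where
  "norm_on X \<psi> = L2_set (\<lambda>S. cmod (\<psi> S)) X"

definition kernel_apply :: "'a set \<Rightarrow> ('a \<Rightarrow> 'a \<Rightarrow> complex) \<Rightarrow> ('a \<Rightarrow> complex) \<Rightarrow> 'a \<Rightarrow> complex" where
  "kernel_apply X k \<psi> = (\<lambda>S. \<Sum>T\<in>X. k S T * \<psi> T)"

definition quad_form :: "'a set \<Rightarrow> ('a \<Rightarrow> 'a \<Rightarrow> complex) \<Rightarrow> ('a \<Rightarrow> complex) \<Rightarrow> real" where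
  "quad_form X k \<psi> = Re (inner_on X \<psi> (kernel_apply X k \<psi>))"

definition hermitian_on :: "'a set \<Rightarrow> ('a \<Rightarrow> 'a \<Rightarrow> complex) \<Rightarrow> bool" where
  "hermitian_on X k \<longleftrightarrow> (\<forall>S\<in>X. \<forall>T\<in>X. k T S = cnj (k S T))"

text \<open>Equations are required only on \<open>X\<close> and values outside \<open>X\<close>
  never matter, so functions need not be cut off when kernels are applied to them.\<close>

definition eigen_on :: "'a set \<Rightarrow> ('a \<Rightarrow> 'a \<Rightarrow> complex) \<Rightarrow> real \<Rightarrow> ('a \<Rightarrow> complex) \<Rightarrow> bool" where
  "eigen_on X k E \<psi> \<longleftrightarrow>
     (\<exists>S\<in>X. \<psi> S \<noteq> 0) \<and> (\<forall>S\<in>X. kernel_apply X k \<psi> S = of_real E * \<psi> S)"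

text \<open>The same \<open>LEAST\<close> shape as \<open>E0\<close>, so that an equivalence of the
  two eigenvalue predicates identifies the two numbers.\<close>

definition lowest_eigenvalue :: "'a set \<Rightarrow> ('a \<Rightarrow> 'a \<Rightarrow> complex) \<Rightarrow> real" where
  "lowest_eigenvalue X k = (LEAST E. \<exists>\<psi>. eigen_on X k E \<psi>)"

lemma norm_on_nonneg [simp]: "0 \<le> norm_on X \<psi>"
  by (simp add: norm_on_def)

lemma norm_on_sq: "(norm_on X \<psi>)\<^sup>2 = (\<Sum>S\<in>X. (cmod (\<psi> S))\<^sup>2)"
  by (simp add: norm_on_def L2_set_def sum_nonneg)

lemma inner_on_self: "inner_on X \<psi> \<psi> = of_real ((norm_on X \<psi>)\<^sup>2)"
  unfolding inner_on_def norm_on_sq of_real_sum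
  by (rule sum.cong) (auto simp: complex_norm_square mult.commute simp flip: of_real_power)

lemma norm_on_eq_0: "finite X \<Longrightarrow> norm_on X \<psi> = 0 \<longleftrightarrow> (\<forall>S\<in>X. \<psi> S = 0)"
  by (simp add: norm_on_def L2_set_eq_0_iff)

lemma norm_on_pos: "finite X \<Longrightarrow> S \<in> X \<Longrightarrow> \<psi> S \<noteq> 0 \<Longrightarrow> 0 < norm_on X \<psi>"
  using norm_on_eq_0[of X \<psi>] norm_on_nonneg[of X \<psi>] by (metis less_eq_real_def)

lemma cmod_le_norm_on: "finite X \<Longrightarrow> S \<in> X \<Longrightarrow> cmod (\<psi> S) \<le> norm_on X \<psi>"
  unfolding norm_on_def by (rule member_le_L2_set)

lemma cmod_inner_on_le: "cmod (inner_on X \<phi> \<psi>) \<le> norm_on X \<phi> * norm_on X \<psi>"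
proof -
  have "cmod (inner_on X \<phi> \<psi>) \<le> (\<Sum>S\<in>X. cmod (cnj (\<phi> S) * \<psi> S))"
    unfolding inner_on_def by (rule norm_sum)
  also have "\<dots> = (\<Sum>S\<in>X. \<bar>cmod (\<phi> S)\<bar> * \<bar>cmod (\<psi> S)\<bar>)"
    by (simp add: norm_mult)
  also have "\<dots> \<le> norm_on X \<phi> * norm_on X \<psi>"
    unfolding norm_on_def by (rule L2_set_mult_ineq)
  finally show ?thesis .
qed

lemma norm_on_triangle: "norm_on X (\<lambda>S. \<phi> S + \<psi> S) \<le> norm_on X \<phi> + norm_on X \<psi>"
proof -
  have "norm_on X (\<lambda>S. \<phi> S + \<psi> S) \<le> L2_set (\<lambda>S. cmod (\<phi> S) + cmod (\<psi> S)) X"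
    unfolding norm_on_def by (rule L2_set_mono) (auto simp: norm_triangle_ineq)
  also have "\<dots> \<le> norm_on X \<phi> + norm_on X \<psi>"
    unfolding norm_on_def by (rule L2_set_triangle_ineq)
  finally show ?thesis .
qed

lemma inner_on_add_right:
  "inner_on X \<phi> (\<lambda>S. \<psi> S + \<eta> S) = inner_on X \<phi> \<psi> + inner_on X \<phi> \<eta>"
  by (simp add: inner_on_def algebra_simps sum.distrib)

lemma inner_on_diff_right:
  "inner_on X \<phi> (\<lambda>S. \<psi> S - \<eta> S) = inner_on X \<phi> \<psi> - inner_on X \<phi> \<eta>"
  by (simp add: inner_on_def algebra_simps sum_subtractf)

lemma inner_on_scale_right: "inner_on X \<phi> (\<lambda>S. c * \<psi> S) = c * inner_on X \<phi> \<psi>"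
  by (simp add: inner_on_def sum_distrib_left algebra_simps)

lemma inner_on_commute: "inner_on X \<psi> \<phi> = cnj (inner_on X \<phi> \<psi>)"
  by (simp add: inner_on_def mult.commute)

lemma inner_on_cong:
  "(\<And>S. S \<in> X \<Longrightarrow> \<phi> S = \<phi>' S) \<Longrightarrow> (\<And>S. S \<in> X \<Longrightarrow> \<psi> S = \<psi>' S) \<Longrightarrow>
     inner_on X \<phi> \<psi> = inner_on X \<phi>' \<psi>'"
  by (simp add: inner_on_def cong: sum.cong)

lemma inner_kernel_apply:
  "inner_on X \<phi> (kernel_apply X k \<psi>) = (\<Sum>S\<in>X. \<Sum>T\<in>X. cnj (\<phi> S) * k S T * \<psi> T)"
  by (simp add: inner_on_def kernel_apply_def sum_distrib_left mult.assoc)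

lemma inner_kernel_apply_hermitian:
  assumes "hermitian_on X k"
  shows "inner_on X (kernel_apply X k \<phi>) \<psi> = inner_on X \<phi> (kernel_apply X k \<psi>)"
proof -
  have "inner_on X (kernel_apply X k \<phi>) \<psi> = (\<Sum>S\<in>X. \<Sum>T\<in>X. cnj (k S T) * cnj (\<phi> T) * \<psi> S)"
    by (simp add: inner_on_def kernel_apply_def sum_distrib_right)
  also have "\<dots> = (\<Sum>S\<in>X. \<Sum>T\<in>X. cnj (k T S) * cnj (\<phi> S) * \<psi> T)"
    by (rule sum.swap)
  also have "\<dots> = inner_on X \<phi> (kernel_apply X k \<psi>)"
    unfolding inner_kernel_apply
  proof (intro sum.cong refl)
    fix S T assume "S \<in> X" "T \<in> X"
    then have "k S T = cnj (k T S)"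
      using assms unfolding hermitian_on_def by blast
    then show "cnj (k T S) * cnj (\<phi> S) * \<psi> T = cnj (\<phi> S) * k S T * \<psi> T"
      by (simp only: mult.commute)
  qed
  finally show ?thesis .
qed

text \<open>Each amplitude is at most the norm, so each of the squared-cardinality many terms is
  bounded separately. The crude constant suffices because only Lipschitz continuity is drawn from
  it.\<close>

lemma inner_kernel_apply_bound:
  assumes "finite X" "\<And>S T. S \<in> X \<Longrightarrow> T \<in> X \<Longrightarrow> cmod (k S T) \<le> B"
  shows "cmod (inner_on X \<phi> (kernel_apply X k \<psi>))
     \<le> B * (real (card X))\<^sup>2 * (norm_on X \<phi> * norm_on X \<psi>)"
proof -
  have "cmod (inner_on X \<phi> (kernel_apply X k \<psi>))
      \<le> (\<Sum>S\<in>X. \<Sum>T\<in>X. cmod (cnj (\<phi> S) * k S T * \<psi> T))"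
    unfolding inner_kernel_apply by (intro norm_sum[THEN order_trans] sum_mono order_refl norm_sum)
  also have "\<dots> \<le> (\<Sum>S\<in>X. \<Sum>T\<in>X. norm_on X \<phi> * B * norm_on X \<psi>)"
  proof (intro sum_mono)
    fix S T assume ST: "S \<in> X" "T \<in> X"
    have "0 \<le> B" using assms(2)[OF ST] norm_ge_zero order_trans by blast
    then show "cmod (cnj (\<phi> S) * k S T * \<psi> T) \<le> norm_on X \<phi> * B * norm_on X \<psi>"
      unfolding norm_mult using ST assms
      by (intro mult_mono) (auto simp: cmod_le_norm_on)
  qed
  also have "\<dots> = B * (real (card X))\<^sup>2 * (norm_on X \<phi> * norm_on X \<psi>)"
    by (simp add: power2_eq_square algebra_simps)
  finally show ?thesis .
qed

lemma kernel_apply_add: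
  "kernel_apply X k (\<lambda>S. \<phi> S + \<psi> S) = (\<lambda>S. kernel_apply X k \<phi> S + kernel_apply X k \<psi> S)"
  by (simp add: kernel_apply_def algebra_simps sum.distrib)

lemma kernel_apply_diff:
  "kernel_apply X k (\<lambda>S. \<phi> S - \<psi> S) = (\<lambda>S. kernel_apply X k \<phi> S - kernel_apply X k \<psi> S)"
  by (simp add: kernel_apply_def algebra_simps sum_subtractf)

lemma kernel_apply_scale:
  "kernel_apply X k (\<lambda>S. c * \<psi> S) = (\<lambda>S. c * kernel_apply X k \<psi> S)"
  by (simp add: kernel_apply_def sum_distrib_left algebra_simps)

lemma kernel_apply_diff_kernel:
  "kernel_apply X (\<lambda>S T. k S T - l S T) \<psi> = (\<lambda>S. kernel_apply X k \<psi> S - kernel_apply X l \<psi> S)"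
  by (simp add: kernel_apply_def algebra_simps sum_subtractf)

lemma quad_form_scale: "quad_form X k (\<lambda>S. of_real c * \<psi> S) = c\<^sup>2 * quad_form X k \<psi>"
proof -
  have "inner_on X (\<lambda>S. of_real c * \<psi> S) (kernel_apply X k (\<lambda>S. of_real c * \<psi> S))
    = of_real (c\<^sup>2) * inner_on X \<psi> (kernel_apply X k \<psi>)"
    unfolding kernel_apply_scale
    by (simp add: inner_on_def sum_distrib_left power2_eq_square mult_ac)
  then show ?thesis by (simp add: quad_form_def)
qed

lemma quad_form_cong: "(\<And>S. S \<in> X \<Longrightarrow> \<phi> S = \<psi> S) \<Longrightarrow> quad_form X k \<phi> = quad_form X k \<psi>"
  by (simp add: quad_form_def inner_on_def kernel_apply_def cong: sum.cong)

lemma quad_form_eigen: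
  "eigen_on X k E \<psi> \<Longrightarrow> quad_form X k \<psi> = E * (norm_on X \<psi>)\<^sup>2"
proof -
  assume e: "eigen_on X k E \<psi>"
  have "inner_on X \<psi> (kernel_apply X k \<psi>) = inner_on X \<psi> (\<lambda>S. of_real E * \<psi> S)"
    using e by (intro inner_on_cong) (auto simp: eigen_on_def)
  then show ?thesis
    by (simp add: quad_form_def inner_on_scale_right inner_on_self)
qed

section \<open>Rayleigh quotients and existence of the lowest eigenvalue\<close>

text \<open>In the product topology the set is a closed part of a product of unit discs over
  \<open>X\<close> and of points elsewhere, which is compact by Tychonoff. Demanding zero outside
  \<open>X\<close> is what makes the other factors compact.\<close>

lemma compact_unit_sphere_on:
  assumes "finite X"
  shows "compact {\<psi> :: 'a \<Rightarrow> complex. (\<forall>S. S \<notin> X \<longrightarrow> \<psi> S = 0) \<and> norm_on X \<psi> = 1 \<and> inner_on X e \<psi> = 0}"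
    (is "compact ?K")
proof -
  let ?B = "\<lambda>S. if S \<in> X then cball 0 1 else {0 :: complex}"
  have B: "compact (PiE UNIV ?B)"
  proof -
    have "compactin (product_topology (\<lambda>_. euclidean) UNIV) (PiE UNIV ?B)"
      by (subst compactin_PiE) auto
    then show ?thesis
      by (simp add: euclidean_product_topology)
  qed
  have cont: "continuous_on UNIV (\<lambda>\<psi> :: 'a \<Rightarrow> complex. norm_on X \<psi>)"
    unfolding norm_on_def L2_set_def by (intro continuous_intros continuous_on_product_coordinates)
  have cont': "continuous_on UNIV (\<lambda>\<psi> :: 'a \<Rightarrow> complex. inner_on X e \<psi>)"
    unfolding inner_on_def by (intro continuous_intros continuous_on_product_coordinates)
  have "closed ({\<psi>. norm_on X \<psi> = 1} \<inter> {\<psi>. inner_on X e \<psi> = 0})"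
    by (intro closed_Int closed_Collect_eq cont cont' continuous_intros)
  then have "compact (PiE UNIV ?B \<inter> ({\<psi>. norm_on X \<psi> = 1} \<inter> {\<psi>. inner_on X e \<psi> = 0}))"
    by (intro compact_Int_closed B)
  also have "PiE UNIV ?B \<inter> ({\<psi>. norm_on X \<psi> = 1} \<inter> {\<psi>. inner_on X e \<psi> = 0}) = ?K"
  proof -
    have "cmod (\<psi> S) \<le> 1" if "norm_on X \<psi> = 1" "S \<in> X" for \<psi> S
      using cmod_le_norm_on[OF assms that(2), of \<psi>] that(1) by simp
    then show ?thesis
      by (auto simp: PiE_def Pi_def split: if_splits)
  qed
  finally show ?thesis .
qed

text \<open>The orthogonality constraint serves two purposes: with \<open>e\<close> zero it is void
  and gives the lowest eigenvalue, with \<open>e\<close> the ground state it gives the gap. The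
  vector \<open>\<psi>0\<close> guarantees a nonempty constrained sphere.\<close>

lemma quad_form_attains_min:
  assumes "finite X" "S0 \<in> X" "\<psi>0 S0 \<noteq> 0" "inner_on X e \<psi>0 = 0"
  obtains \<psi> where "norm_on X \<psi> = 1" "inner_on X e \<psi> = 0"
    "\<And>\<phi>. inner_on X e \<phi> = 0 \<Longrightarrow> quad_form X k \<psi> * (norm_on X \<phi>)\<^sup>2 \<le> quad_form X k \<phi>"
proof -
  let ?K = "{\<psi> :: 'a \<Rightarrow> complex. (\<forall>S. S \<notin> X \<longrightarrow> \<psi> S = 0) \<and> norm_on X \<psi> = 1 \<and> inner_on X e \<psi> = 0}"
  define n where "n \<phi> = (\<lambda>S. if S \<in> X then of_real (1 / norm_on X \<phi>) * \<phi> S else 0)" for \<phi> :: "'a \<Rightarrow> complex"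
  have n: "n \<phi> \<in> ?K" "quad_form X k (n \<phi>) = quad_form X k \<phi> / (norm_on X \<phi>)\<^sup>2"
    if "inner_on X e \<phi> = 0" "norm_on X \<phi> \<noteq> 0" for \<phi>
  proof -
    have "inner_on X e (n \<phi>) = inner_on X e (\<lambda>S. of_real (1 / norm_on X \<phi>) * \<phi> S)"
      by (rule inner_on_cong) (auto simp: n_def)
    also have "\<dots> = 0" using that by (simp only: inner_on_scale_right mult_zero_right)
    finally have "inner_on X e (n \<phi>) = 0" .
    moreover have "(norm_on X (n \<phi>))\<^sup>2 = (\<Sum>S\<in>X. (cmod (\<phi> S))\<^sup>2) / (norm_on X \<phi>)\<^sup>2"
      unfolding norm_on_sq[of X "n \<phi>"] sum_divide_distrib
      by (rule sum.cong) (auto simp: n_def norm_divide power_divide)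
    then have "(norm_on X (n \<phi>))\<^sup>2 = 1"
      using that by (simp flip: norm_on_sq)
    then have "norm_on X (n \<phi>) = 1"
      using norm_on_nonneg[of X "n \<phi>"] by (simp add: power2_eq_1_iff)
    ultimately show "n \<phi> \<in> ?K" by (auto simp: n_def)
    have "quad_form X k (n \<phi>) = quad_form X k (\<lambda>S. of_real (1 / norm_on X \<phi>) * \<phi> S)"
      by (rule quad_form_cong) (auto simp: n_def)
    then show "quad_form X k (n \<phi>) = quad_form X k \<phi> / (norm_on X \<phi>)\<^sup>2"
      unfolding quad_form_scale by (simp add: power_divide)
  qed
  have "n \<psi>0 \<in> ?K"
    using assms by (intro n) (auto simp: norm_on_eq_0)
  then have ne: "?K \<noteq> {}" by blast
  have "continuous_on ?K (quad_form X k)"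
    unfolding quad_form_def inner_kernel_apply
    by (rule continuous_on_subset[of UNIV]) (auto intro!: continuous_intros)
  from continuous_attains_inf[OF compact_unit_sphere_on[OF assms(1), of e] ne this]
  obtain \<psi> where \<psi>: "\<psi> \<in> ?K" "\<And>\<phi>. \<phi> \<in> ?K \<Longrightarrow> quad_form X k \<psi> \<le> quad_form X k \<phi>" by blast
  show ?thesis
  proof
    fix \<phi> assume \<phi>: "inner_on X e \<phi> = 0"
    show "quad_form X k \<psi> * (norm_on X \<phi>)\<^sup>2 \<le> quad_form X k \<phi>"
    proof (cases "norm_on X \<phi> = 0")
      case True
      then have "quad_form X k \<phi> = quad_form X k (\<lambda>_. 0)"
        using assms(1) by (intro quad_form_cong) (simp add: norm_on_eq_0)
      with True show ?thesis by (simp add: quad_form_def inner_kernel_apply)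
    next
      case False
      then show ?thesis
        using \<psi>(2)[OF n(1)[OF \<phi> False]] n(2)[OF \<phi> False] norm_on_nonneg[of X \<phi>]
        by (simp add: field_simps)
    qed
  qed (use \<psi> in auto)
qed

text \<open>The first variation of the form minus \<open>m\<close> times the squared norm must
  vanish at a minimiser; it is tested in one direction only, the residual of the eigenvalue
  equation.\<close>

lemma quad_form_min_imp_eigen:
  assumes "hermitian_on X k" "finite X"
    and min: "\<And>\<phi>. m * (norm_on X \<phi>)\<^sup>2 \<le> quad_form X k \<phi>"
    and \<psi>: "quad_form X k \<psi> = m * (norm_on X \<psi>)\<^sup>2"
    and S: "S \<in> X"
  shows "kernel_apply X k \<psi> S = of_real m * \<psi> S"
proof -
  let ?F = "\<lambda>\<phi>. quad_form X k \<phi> - m * (norm_on X \<phi>)\<^sup>2"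
  define r where "r S = kernel_apply X k \<psi> S - of_real m * \<psi> S" for S
  have expand: "?F (\<lambda>S. \<psi> S + of_real t * r S) = 2 * t * (norm_on X r)\<^sup>2 + t\<^sup>2 * ?F r" for t :: real
  proof -
    let ?i = "inner_on X" and ?K = "kernel_apply X k"
    have q: "quad_form X k (\<lambda>S. \<psi> S + of_real t * r S)
      = quad_form X k \<psi> + t\<^sup>2 * quad_form X k r + 2 * t * Re (?i r (?K \<psi>))"
    proof -
      have 1: "Re (?i \<psi> (?K r)) = Re (?i r (?K \<psi>))"
        using inner_kernel_apply_hermitian[OF assms(1), of \<psi> r]
          inner_on_commute[of X r "?K \<psi>"] by simp
      have "?i (\<lambda>S. \<psi> S + of_real t * r S) (?K (\<lambda>S. \<psi> S + of_real t * r S))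
        = ?i \<psi> (?K \<psi>) + t * ?i \<psi> (?K r) + t * ?i r (?K \<psi>) + t * (t * ?i r (?K r))"
        unfolding kernel_apply_add kernel_apply_scale
        by (simp add: inner_on_def algebra_simps sum.distrib sum_distrib_left)
      then show ?thesis
        using 1 by (simp add: quad_form_def power2_eq_square)
    qed
    have n: "(norm_on X (\<lambda>S. \<psi> S + of_real t * r S))\<^sup>2
      = (norm_on X \<psi>)\<^sup>2 + t\<^sup>2 * (norm_on X r)\<^sup>2 + 2 * t * Re (?i r \<psi>)"
    proof -
      have 1: "Re (?i \<psi> r) = Re (?i r \<psi>)"
        using inner_on_commute[of X r \<psi>] by simp
      have "?i (\<lambda>S. \<psi> S + of_real t * r S) (\<lambda>S. \<psi> S + of_real t * r S)
        = ?i \<psi> \<psi> + t * ?i \<psi> r + t * ?i r \<psi> + t * (t * ?i r r)"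
        by (simp add: inner_on_def algebra_simps sum.distrib sum_distrib_left)
      then have "Re (?i (\<lambda>S. \<psi> S + of_real t * r S) (\<lambda>S. \<psi> S + of_real t * r S))
        = Re (?i \<psi> \<psi>) + t * Re (?i r \<psi>) + t * Re (?i r \<psi>) + t * (t * Re (?i r r))"
        using 1 by simp
      then show ?thesis
        unfolding inner_on_self Re_complex_of_real by (simp add: power2_eq_square)
    qed
    have "Re (?i r (?K \<psi>)) - m * Re (?i r \<psi>) = Re (?i r r)"
      by (simp add: r_def[abs_def] inner_on_diff_right inner_on_scale_right)
    also have "\<dots> = (norm_on X r)\<^sup>2"
      by (simp add: inner_on_self)
    finally have "2 * t * Re (?i r (?K \<psi>)) = 2 * t * ((norm_on X r)\<^sup>2 + m * Re (?i r \<psi>))"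
      by simp
    then show ?thesis
      using q n \<psi> by (simp add: algebra_simps)
  qed
  have "norm_on X r = 0"
  proof (rule ccontr)
    assume "norm_on X r \<noteq> 0"
    then have pos: "(norm_on X r)\<^sup>2 > 0" by simp
    let ?A = "(norm_on X r)\<^sup>2" and ?B = "?F r"
    have B: "?B \<ge> 0" using min[of r] by simp
    \<comment> \<open>A negative step so short that the linear term wins: the value becomes -A^2 (B
      + 2) / (B + 1)^2. The added 1 keeps the denominator positive when B is 0.\<close>
    define t where "t = - ?A / (?B + 1)"
    have "0 \<le> 2 * t * ?A + t\<^sup>2 * ?B"
      using min[of "\<lambda>S. \<psi> S + of_real t * r S"] expand[of t] by simp
    moreover have "2 * t * ?A + t\<^sup>2 * ?B < 0"
    proof -
      have *: "2 * (- x / (y + 1)) * x + (- x / (y + 1))\<^sup>2 * y = - (x\<^sup>2 * (y + 2) / (y + 1)\<^sup>2)"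
        if "y \<ge> 0" for x y :: real
        using that by (simp add: divide_simps power2_eq_square) (simp add: algebra_simps)
      have "x\<^sup>2 * (y + 2) / (y + 1)\<^sup>2 > 0" if "x > 0" "y \<ge> 0" for x y :: real
        using that by simp
      from this[OF pos B] have "?A\<^sup>2 * (?B + 2) / (?B + 1)\<^sup>2 > 0" .
      show ?thesis
        unfolding t_def using *[OF B, of ?A] \<open>0 < ?A\<^sup>2 * (?B + 2) / (?B + 1)\<^sup>2\<close> by linarith
    qed
    ultimately show False by simp
  qed
  then show ?thesis
    using assms(2) S by (simp add: norm_on_eq_0 r_def)
qed

text \<open>The minimum of the Rayleigh quotient is an eigenvalue, and every eigenvalue is a value
  of the quotient, so the \<open>LEAST\<close> is attained and equals that minimum.\<close>

lemma lowest_eigenvalue: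
  assumes "hermitian_on X k" "finite X" "X \<noteq> {}"
  shows "\<exists>\<psi>. eigen_on X k (lowest_eigenvalue X k) \<psi>"
    and "lowest_eigenvalue X k * (norm_on X \<phi>)\<^sup>2 \<le> quad_form X k \<phi>"
proof -
  obtain S0 where S0: "S0 \<in> X" using assms(3) by blast
  obtain \<psi> where \<psi>: "norm_on X \<psi> = 1"
    "\<And>\<phi>. quad_form X k \<psi> * (norm_on X \<phi>)\<^sup>2 \<le> quad_form X k \<phi>"
    by (rule quad_form_attains_min[OF assms(2) S0, of "\<lambda>_. 1" "\<lambda>_. 0" k]) (auto simp: inner_on_def)
  have eig: "eigen_on X k (quad_form X k \<psi>) \<psi>"
    unfolding eigen_on_def
  proof
    show "\<exists>S\<in>X. \<psi> S \<noteq> 0"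
      using \<psi>(1) norm_on_eq_0[OF assms(2), of \<psi>] by auto
    show "\<forall>S\<in>X. kernel_apply X k \<psi> S = of_real (quad_form X k \<psi>) * \<psi> S"
      using quad_form_min_imp_eigen[OF assms(1,2) \<psi>(2)] \<psi>(1) by simp
  qed
  have le: "quad_form X k \<psi> \<le> E" if "eigen_on X k E \<eta>" for E \<eta>
  proof -
    have "norm_on X \<eta> > 0"
      using that norm_on_pos[OF assms(2)] unfolding eigen_on_def by blast
    then have "(norm_on X \<eta>)\<^sup>2 > 0" by simp
    then show ?thesis
      using \<psi>(2)[of \<eta>] quad_form_eigen[OF that] by simp
  qed
  have "lowest_eigenvalue X k = quad_form X k \<psi>"
    unfolding lowest_eigenvalue_def using eig le by (intro Least_equality) auto
  then show "\<exists>\<psi>. eigen_on X k (lowest_eigenvalue X k) \<psi>"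
    and "lowest_eigenvalue X k * (norm_on X \<phi>)\<^sup>2 \<le> quad_form X k \<phi>"
    using eig \<psi>(2) by auto
qed

section \<open>Perturbation of a simple lowest eigenvalue\<close>

lemma has_vector_derivative_imp_tendsto:
  fixes f :: "real \<Rightarrow> complex"
  assumes "(f has_vector_derivative D) (at t)"
  shows "((\<lambda>s. (f s - f t) / of_real (s - t)) \<longlongrightarrow> D) (at t)"
proof -
  have "((\<lambda>s. norm (f s - f t - (s - t) *\<^sub>R D) / norm (s - t)) \<longlongrightarrow> 0) (at t)"
    using assms unfolding has_vector_derivative_def has_derivative_iff_norm by blast
  moreover have "\<forall>\<^sub>F s in at t. norm (f s - f t - (s - t) *\<^sub>R D) / norm (s - t)
      = norm ((f s - f t) / of_real (s - t) - D)"
    using eventually_neq_at_within[of t]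
  proof eventually_elim
    case (elim s)
    then have "(f s - f t) / of_real (s - t) - D = (f s - f t - (s - t) *\<^sub>R D) / of_real (s - t)"
      by (simp add: diff_divide_distrib scaleR_conv_of_real)
    then show ?case by (simp only: norm_divide norm_of_real real_norm_def)
  qed
  ultimately have "((\<lambda>s. norm ((f s - f t) / of_real (s - t) - D)) \<longlongrightarrow> 0) (at t)"
    by (rule Lim_transform_eventually)
  then show ?thesis
    by (rule LIM_zero_cancel[OF tendsto_norm_zero_cancel])
qed

text \<open>\<open>kernel\<close> makes the eigenvalue 0 simple, and \<open>h'_e\<close> suppresses
  the contribution of the excited states to the second derivative. The second derivative of the
  kernel is needed at 0 only.\<close>

locale perturbed_ground_state =
  fixes X :: "'a set" and h h' :: "real \<Rightarrow> 'a \<Rightarrow> 'a \<Rightarrow> complex" and h'' :: "'a \<Rightarrow> 'a \<Rightarrow> complex"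
    and c :: real and e :: "'a \<Rightarrow> complex"
  assumes finite: "finite X"
    and hermitian: "hermitian_on X (h t)"
    and hermitian': "hermitian_on X (h' t)"
    and lipschitz: "S \<in> X \<Longrightarrow> T \<in> X \<Longrightarrow> cmod (h s S T - h t S T) \<le> c * \<bar>s - t\<bar>"
    and deriv: "S \<in> X \<Longrightarrow> T \<in> X \<Longrightarrow> ((\<lambda>t. h t S T) has_vector_derivative h' t S T) (at t)"
    and deriv': "S \<in> X \<Longrightarrow> T \<in> X \<Longrightarrow> ((\<lambda>t. h' t S T) has_vector_derivative h'' S T) (at 0)"
    and nonneg: "0 \<le> quad_form X (h 0) \<psi>"
    and kernel: "quad_form X (h 0) \<psi> = 0 \<Longrightarrow> \<exists>a. \<forall>S\<in>X. \<psi> S = a * e S"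
    and e_nonzero: "\<exists>S\<in>X. e S \<noteq> 0"
    and h_e: "S \<in> X \<Longrightarrow> kernel_apply X (h 0) e S = 0"
    and h'_e: "S \<in> X \<Longrightarrow> kernel_apply X (h' 0) e S = 0"
begin

abbreviation E :: "real \<Rightarrow> real" where "E t \<equiv> lowest_eigenvalue X (h t)"
abbreviation ip where "ip \<equiv> inner_on X"
abbreviation nm where "nm \<equiv> norm_on X"
abbreviation ap where "ap t \<equiv> kernel_apply X (h t)"

text \<open>The added 1 makes \<open>C\<close> positive even when \<open>c\<close> is 0, since the
  radius \<open>r\<close> divides by it.\<close>

definition C :: real where "C = c * (real (card X))\<^sup>2 + 1"

lemma nonempty: "X \<noteq> {}"
  using e_nonzero by blast

lemma norm_e: "nm e > 0"
  using e_nonzero norm_on_pos[OF finite] by blast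

lemma c_nonneg: "0 \<le> c"
proof -
  obtain S where "S \<in> X" using nonempty by blast
  from order_trans[OF norm_ge_zero lipschitz[OF this this, of 1 0]] show ?thesis
    by simp
qed

lemma C_pos: "C > 0"
  using c_nonneg by (simp add: C_def add_nonneg_pos)

lemma diff_bound: "cmod (ip \<phi> (\<lambda>S. ap s \<psi> S - ap t \<psi> S)) \<le> C * \<bar>s - t\<bar> * (nm \<phi> * nm \<psi>)"
proof -
  have "cmod (ip \<phi> (\<lambda>S. ap s \<psi> S - ap t \<psi> S))
      \<le> c * \<bar>s - t\<bar> * (real (card X))\<^sup>2 * (nm \<phi> * nm \<psi>)"
    unfolding kernel_apply_diff_kernel[symmetric]
    by (rule inner_kernel_apply_bound[OF finite lipschitz])
  also have "\<dots> \<le> C * \<bar>s - t\<bar> * (nm \<phi> * nm \<psi>)"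
  proof (rule mult_right_mono)
    show "c * \<bar>s - t\<bar> * (real (card X))\<^sup>2 \<le> C * \<bar>s - t\<bar>"
      by (simp add: C_def algebra_simps)
  qed simp
  finally show ?thesis .
qed

lemma quad_form_diff_bound: "\<bar>quad_form X (h s) \<psi> - quad_form X (h t) \<psi>\<bar> \<le> C * \<bar>s - t\<bar> * (nm \<psi>)\<^sup>2"
proof -
  have "\<bar>quad_form X (h s) \<psi> - quad_form X (h t) \<psi>\<bar> = \<bar>Re (ip \<psi> (\<lambda>S. ap s \<psi> S - ap t \<psi> S))\<bar>"
    by (simp add: quad_form_def inner_on_diff_right)
  also have "\<dots> \<le> C * \<bar>s - t\<bar> * (nm \<psi>)\<^sup>2"
    using order_trans[OF abs_Re_le_cmod diff_bound[of \<psi> s \<psi> t]] by (simp add: power2_eq_square)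
  finally show ?thesis .
qed

lemma E_le: "E t * (nm \<phi>)\<^sup>2 \<le> quad_form X (h t) \<phi>"
  by (rule lowest_eigenvalue(2)[OF hermitian finite nonempty])

text \<open>The eigenvector at \<open>t\<close> is a trial vector for the form at \<open>s\<close>;
  exchanging \<open>s\<close> and \<open>t\<close> gives the other inequality.\<close>

lemma E_lipschitz: "\<bar>E s - E t\<bar> \<le> C * \<bar>s - t\<bar>"
proof -
  have *: "E s - E t \<le> C * \<bar>s - t\<bar>" for s t
  proof -
    obtain \<psi> where \<psi>: "eigen_on X (h t) (E t) \<psi>"
      using lowest_eigenvalue(1)[OF hermitian finite nonempty] by blast
    then have pos: "(nm \<psi>)\<^sup>2 > 0"
      using norm_on_pos[OF finite] unfolding eigen_on_def by (meson zero_less_power)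
    have "E s * (nm \<psi>)\<^sup>2 \<le> quad_form X (h t) \<psi> + C * \<bar>s - t\<bar> * (nm \<psi>)\<^sup>2"
      using E_le[of s \<psi>] quad_form_diff_bound[of s \<psi> t] by linarith
    also have "\<dots> = (E t + C * \<bar>s - t\<bar>) * (nm \<psi>)\<^sup>2"
      by (simp add: quad_form_eigen[OF \<psi>] algebra_simps)
    finally show ?thesis using pos by simp
  qed
  from *[of s t] *[of t s] show ?thesis by (simp add: abs_minus_commute abs_le_iff)
qed

lemma E_0: "E 0 = 0"
proof -
  obtain \<psi> where \<psi>: "eigen_on X (h 0) (E 0) \<psi>"
    using lowest_eigenvalue(1)[OF hermitian finite nonempty] by blast
  then have pos: "(nm \<psi>)\<^sup>2 > 0"
    using norm_on_pos[OF finite] unfolding eigen_on_def by (meson zero_less_power)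
  have "0 \<le> E 0 * (nm \<psi>)\<^sup>2"
    using nonneg[of \<psi>] quad_form_eigen[OF \<psi>] by simp
  then have "0 \<le> E 0"
    using pos by (simp add: zero_le_mult_iff)
  moreover have "quad_form X (h 0) e = 0"
    using h_e by (simp add: quad_form_def inner_on_def)
  then have "E 0 \<le> 0"
    using E_le[of 0 e] norm_e by (simp add: mult_le_0_iff)
  ultimately show ?thesis by simp
qed

section \<open>Spectral gap and continuation of the ground state\<close>

text \<open>The minimum over the unit vectors orthogonal to \<open>e\<close> is attained; were it 0,
  the minimiser would be a multiple of \<open>e\<close> and hence vanish.\<close>

lemma gap: "\<exists>g>0. \<forall>\<phi>. ip e \<phi> = 0 \<longrightarrow> g * (nm \<phi>)\<^sup>2 \<le> quad_form X (h 0) \<phi>"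
proof (cases "\<exists>\<phi>. ip e \<phi> = 0 \<and> (\<exists>S\<in>X. \<phi> S \<noteq> 0)")
  case True
  then obtain \<phi>0 S0 where \<phi>0: "S0 \<in> X" "\<phi>0 S0 \<noteq> 0" "ip e \<phi>0 = 0" by auto
  obtain \<psi> where \<psi>: "nm \<psi> = 1" "ip e \<psi> = 0"
    "\<And>\<phi>. ip e \<phi> = 0 \<Longrightarrow> quad_form X (h 0) \<psi> * (nm \<phi>)\<^sup>2 \<le> quad_form X (h 0) \<phi>"
    by (rule quad_form_attains_min[OF finite \<phi>0, of "h 0"]) blast
  have "quad_form X (h 0) \<psi> \<noteq> 0"
  proof
    assume "quad_form X (h 0) \<psi> = 0"
    from kernel[OF this] obtain a where a: "\<And>S. S \<in> X \<Longrightarrow> \<psi> S = a * e S" by blast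
    have "ip e \<psi> = a * ip e e"
      unfolding inner_on_scale_right[symmetric] using a by (intro inner_on_cong) auto
    then have "a = 0"
      using \<psi>(2) norm_e by (simp add: inner_on_self)
    with a have "nm \<psi> = 0" using finite by (simp add: norm_on_eq_0)
    with \<psi>(1) show False by simp
  qed
  with nonneg[of \<psi>] have "quad_form X (h 0) \<psi> > 0" by linarith
  with \<psi>(3) show ?thesis by (intro exI[of _ "quad_form X (h 0) \<psi>"]) simp
next
  case False
  then have "nm \<phi> = 0" if "ip e \<phi> = 0" for \<phi>
    using that finite by (auto simp: norm_on_eq_0)
  then show ?thesis
    \<comment> \<open>Only vectors vanishing on \<open>X\<close> are orthogonal to \<open>e\<close>
      here, so any positive number works.\<close>
    using nonneg by (intro exI[of _ 1]) simp
qed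

definition g :: real where
  "g = (SOME g. g > 0 \<and> (\<forall>\<phi>. ip e \<phi> = 0 \<longrightarrow> g * (nm \<phi>)\<^sup>2 \<le> quad_form X (h 0) \<phi>))"

lemma g_pos: "g > 0" and g_le: "ip e \<phi> = 0 \<Longrightarrow> g * (nm \<phi>)\<^sup>2 \<le> quad_form X (h 0) \<phi>"
  using someI_ex[OF gap, folded g_def] by simp_all

text \<open>For times below \<open>r\<close> the form and the eigenvalue each cost at most
  \<open>g / 8\<close> of the gap. The 8 is fixed by the a priori bound in
  \<open>\<Psi>_lipschitz\<close>, where \<open>4 * C / g * r\<close> has to be 1/2.\<close>

definition r :: real where "r = g / (8 * C)"

lemma r_pos: "r > 0"
  using g_pos C_pos by (simp add: r_def)

lemma shifted_gap:
  assumes "\<bar>t\<bar> < r" "ip e \<phi> = 0"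
  shows "g / 2 * (nm \<phi>)\<^sup>2 \<le> quad_form X (h t) \<phi> - E t * (nm \<phi>)\<^sup>2"
proof -
  have "C * \<bar>t\<bar> \<le> g / 8"
    using assms(1) C_pos by (simp add: r_def field_simps)
  then have "C * \<bar>t\<bar> * (nm \<phi>)\<^sup>2 \<le> g / 8 * (nm \<phi>)\<^sup>2" "E t * (nm \<phi>)\<^sup>2 \<le> g / 8 * (nm \<phi>)\<^sup>2"
    using E_lipschitz[of t 0] E_0 by (auto intro!: mult_right_mono simp del: times_divide_eq_left)
  then show ?thesis
    using quad_form_diff_bound[of t \<phi> 0] g_le[OF assms(2)] g_pos
      mult_nonneg_nonneg[of g "(nm \<phi>)\<^sup>2"] by (simp add: abs_le_iff)
qed

text \<open>A lowest eigenvector orthogonal to \<open>e\<close> would violate the gap that survives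
  at \<open>t\<close>, so its overlap with \<open>e\<close> is nonzero and can be rescaled to any
  value.\<close>

lemma eigenvector_exists:
  assumes t: "\<bar>t\<bar> < r"
  shows "\<exists>\<psi>. (\<forall>S\<in>X. ap t \<psi> S = of_real (E t) * \<psi> S) \<and> ip e \<psi> = ip e e"
proof -
  obtain \<psi> where \<psi>: "eigen_on X (h t) (E t) \<psi>"
    using lowest_eigenvalue(1)[OF hermitian finite nonempty] by blast
  then have pos: "(nm \<psi>)\<^sup>2 > 0"
    using norm_on_pos[OF finite] unfolding eigen_on_def by (meson zero_less_power)
  have "ip e \<psi> \<noteq> 0"
  proof
    assume "ip e \<psi> = 0"
    from shifted_gap[OF t this] have "g / 2 * (nm \<psi>)\<^sup>2 \<le> 0"
      by (simp add: quad_form_eigen[OF \<psi>])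
    with pos g_pos show False by (simp add: mult_le_0_iff)
  qed
  moreover have "\<forall>S\<in>X. ap t \<psi> S = of_real (E t) * \<psi> S"
    using \<psi> by (simp add: eigen_on_def)
  ultimately show ?thesis
    by (intro exI[of _ "\<lambda>S. (ip e e / ip e \<psi>) * \<psi> S"])
      (simp only: kernel_apply_scale inner_on_scale_right, simp)
qed

text \<open>Fixing the overlap with \<open>e\<close> instead of the norm settles the phase as well
  and makes the difference of two such eigenvectors orthogonal to \<open>e\<close>, where the gap
  applies.\<close>

definition \<Psi> :: "real \<Rightarrow> 'a \<Rightarrow> complex" where
  "\<Psi> t = (SOME \<psi>. (\<forall>S\<in>X. ap t \<psi> S = of_real (E t) * \<psi> S) \<and> ip e \<psi> = ip e e)"

lemma \<Psi>:
  assumes "\<bar>t\<bar> < r"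
  shows "S \<in> X \<Longrightarrow> ap t (\<Psi> t) S = of_real (E t) * \<Psi> t S" and "ip e (\<Psi> t) = ip e e"
  using someI_ex[OF eigenvector_exists[OF assms], folded \<Psi>_def] by simp_all

lemma \<Psi>_0: "S \<in> X \<Longrightarrow> \<Psi> 0 S = e S"
proof -
  have r0: "\<bar>0\<bar> < r" using r_pos by simp
  have "quad_form X (h 0) (\<Psi> 0) = 0"
    using \<Psi>(1)[OF r0] by (simp add: quad_form_def inner_on_def E_0)
  from kernel[OF this] obtain a where a: "\<And>S. S \<in> X \<Longrightarrow> \<Psi> 0 S = a * e S" by blast
  have "ip e (\<Psi> 0) = a * ip e e"
    unfolding inner_on_scale_right[symmetric] using a by (intro inner_on_cong) auto
  then have "a = 1"
    using \<Psi>(2)[OF r0] norm_e by (simp add: inner_on_self)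
  with a show "S \<in> X \<Longrightarrow> \<Psi> 0 S = e S" by simp
qed

text \<open>The difference \<open>\<delta>\<close> solves (h t - E t) \<delta> = (E s - E t) \<Psi>
  s - (h s - h t) \<Psi> s. Pairing with \<open>\<delta>\<close>, the gap bounds the left side below
  by the square of its norm, while both terms on the right are O(s - t) times that norm.\<close>

lemma \<Psi>_diff:
  assumes "\<bar>s\<bar> < r" "\<bar>t\<bar> < r"
  shows "nm (\<lambda>S. \<Psi> s S - \<Psi> t S) \<le> 4 * C / g * \<bar>s - t\<bar> * nm (\<Psi> s)"
proof -
  define \<delta> where "\<delta> = (\<lambda>S. \<Psi> s S - \<Psi> t S)"
  have orth: "ip e \<delta> = 0"
    using \<Psi>(2)[OF assms(1)] \<Psi>(2)[OF assms(2)] by (simp add: \<delta>_def inner_on_diff_right)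
  have "ip \<delta> (ap t \<delta>) - of_real (E t) * ip \<delta> \<delta> = ip \<delta> (\<lambda>S. ap t \<delta> S - of_real (E t) * \<delta> S)"
    by (simp add: inner_on_diff_right inner_on_scale_right)
  also have "\<dots> = ip \<delta> (\<lambda>S. of_real (E s - E t) * \<Psi> s S - (ap s (\<Psi> s) S - ap t (\<Psi> s) S))"
    using \<Psi>(1)[OF assms(1)] \<Psi>(1)[OF assms(2)]
    by (intro inner_on_cong) (auto simp: \<delta>_def kernel_apply_diff algebra_simps)
  also have "\<dots> = of_real (E s - E t) * ip \<delta> (\<Psi> s) - ip \<delta> (\<lambda>S. ap s (\<Psi> s) S - ap t (\<Psi> s) S)"
    unfolding inner_on_diff_right[of X \<delta> "\<lambda>S. of_real (E s - E t) * \<Psi> s S"] inner_on_scale_right ..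
  finally have eq: "ip \<delta> (ap t \<delta>) - of_real (E t) * ip \<delta> \<delta> =
    of_real (E s - E t) * ip \<delta> (\<Psi> s) - ip \<delta> (\<lambda>S. ap s (\<Psi> s) S - ap t (\<Psi> s) S)" .
  have "g / 2 * (nm \<delta>)\<^sup>2 \<le> quad_form X (h t) \<delta> - E t * (nm \<delta>)\<^sup>2"
    by (rule shifted_gap[OF assms(2) orth])
  also have "\<dots> = Re (ip \<delta> (ap t \<delta>) - of_real (E t) * ip \<delta> \<delta>)"
    by (simp add: quad_form_def inner_on_self)
  also have "\<dots> \<le> cmod (ip \<delta> (ap t \<delta>) - of_real (E t) * ip \<delta> \<delta>)"
    by (rule complex_Re_le_cmod)
  also have "\<dots> \<le> \<bar>E s - E t\<bar> * cmod (ip \<delta> (\<Psi> s)) + cmod (ip \<delta> (\<lambda>S. ap s (\<Psi> s) S - ap t (\<Psi> s) S))"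
    unfolding eq by (rule order_trans[OF norm_triangle_ineq4]) (simp add: norm_mult del: of_real_diff)
  also have "\<dots> \<le> C * \<bar>s - t\<bar> * (nm \<delta> * nm (\<Psi> s)) + C * \<bar>s - t\<bar> * (nm \<delta> * nm (\<Psi> s))"
    using C_pos by (intro add_mono mult_mono E_lipschitz cmod_inner_on_le diff_bound) auto
  finally have "nm \<delta> * (g / 2 * nm \<delta>) \<le> nm \<delta> * (2 * C * \<bar>s - t\<bar> * nm (\<Psi> s))"
    by (simp add: power2_eq_square algebra_simps)
  then have "nm \<delta> = 0 \<or> g / 2 * nm \<delta> \<le> 2 * C * \<bar>s - t\<bar> * nm (\<Psi> s)"
    unfolding mult_le_cancel_left using norm_on_nonneg[of X \<delta>] by linarith
  then have "nm \<delta> \<le> 4 * C / g * \<bar>s - t\<bar> * nm (\<Psi> s)"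
  proof
    assume "nm \<delta> = 0"
    then show ?thesis using C_pos g_pos by simp
  next
    assume "g / 2 * nm \<delta> \<le> 2 * C * \<bar>s - t\<bar> * nm (\<Psi> s)"
    then show ?thesis using g_pos by (simp add: field_simps)
  qed
  then show ?thesis by (simp add: \<delta>_def)
qed

text \<open>The factor \<open>4 * C / g\<close> of \<open>\<Psi>_diff\<close> times the uniform
  bound \<open>2 * nm e\<close> on the norm of the eigenvectors.\<close>

definition D :: real where "D = 8 * C / g * nm e"

lemma \<Psi>_lipschitz:
  assumes "\<bar>s\<bar> < r" "\<bar>t\<bar> < r" "S \<in> X"
  shows "cmod (\<Psi> s S - \<Psi> t S) \<le> D * \<bar>s - t\<bar>"
proof -
  \<comment> \<open>Comparison with time 0 bounds the norm by itself with factor 1/2, which is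
    absorbed on the left.\<close>
  have b: "nm (\<Psi> s) \<le> 2 * nm e"
  proof -
    have "nm (\<Psi> s) = nm (\<lambda>S. \<Psi> 0 S + (\<Psi> s S - \<Psi> 0 S))" by simp
    also have "\<dots> \<le> nm (\<Psi> 0) + nm (\<lambda>S. \<Psi> s S - \<Psi> 0 S)"
      by (rule norm_on_triangle)
    also have "nm (\<Psi> 0) = nm e"
      unfolding norm_on_def by (rule L2_set_cong) (auto simp: \<Psi>_0)
    also have "nm (\<lambda>S. \<Psi> s S - \<Psi> 0 S) \<le> 4 * C / g * \<bar>s\<bar> * nm (\<Psi> s)"
      using \<Psi>_diff[OF assms(1), of 0] r_pos by simp
    also have "\<dots> \<le> 1 / 2 * nm (\<Psi> s)"
      using assms(1) g_pos C_pos by (intro mult_right_mono) (auto simp: r_def field_simps)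
    finally show ?thesis by simp
  qed
  have "cmod (\<Psi> s S - \<Psi> t S) \<le> nm (\<lambda>S. \<Psi> s S - \<Psi> t S)"
    by (rule cmod_le_norm_on[OF finite assms(3), of "\<lambda>S. \<Psi> s S - \<Psi> t S"])
  also have "\<dots> \<le> 4 * C / g * \<bar>s - t\<bar> * nm (\<Psi> s)"
    by (rule \<Psi>_diff[OF assms(1,2)])
  also have "\<dots> \<le> 4 * C / g * \<bar>s - t\<bar> * (2 * nm e)"
    using b g_pos C_pos by (intro mult_left_mono) auto
  finally show ?thesis by (simp add: D_def algebra_simps)
qed

lemma near: "\<bar>t\<bar> < r \<Longrightarrow> \<forall>\<^sub>F s in at t. \<bar>s\<bar> < r"
  by (rule eventually_at_in_open'[of "{-r<..<r}", THEN eventually_mono]) (auto simp: abs_less_iff)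

lemma \<Psi>_tendsto:
  assumes t: "\<bar>t\<bar> < r" and S: "S \<in> X"
  shows "((\<lambda>s. \<Psi> s S) \<longlongrightarrow> \<Psi> t S) (at t)"
proof (rule Lim_transform_bound[where g = "\<lambda>s. D * \<bar>s - t\<bar>", THEN LIM_zero_cancel])
  show "\<forall>\<^sub>F s in at t. norm (\<Psi> s S - \<Psi> t S) \<le> norm (D * \<bar>s - t\<bar>)"
    using near[OF t] by eventually_elim (rule order_trans[OF \<Psi>_lipschitz[OF _ t S]], auto)
  show "((\<lambda>s. D * \<bar>s - t\<bar>) \<longlongrightarrow> 0) (at t)"
    by (auto intro!: tendsto_eq_intros)
qed

section \<open>First and second derivative of the lowest eigenvalue\<close>

lemma \<Psi>_norm: "\<bar>t\<bar> < r \<Longrightarrow> nm (\<Psi> t) > 0"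
proof -
  assume t: "\<bar>t\<bar> < r"
  have "\<exists>S\<in>X. \<Psi> t S \<noteq> 0"
  proof (rule ccontr)
    assume "\<not> ?thesis"
    then have "ip e (\<Psi> t) = 0" by (simp add: inner_on_def)
    with \<Psi>(2)[OF t] norm_e show False by (simp add: inner_on_self)
  qed
  then show ?thesis using norm_on_pos[OF finite] by blast
qed

text \<open>
  Pairing the eigenvector at \<open>t\<close> with the one at \<open>s\<close> gives
  \<open>(E s - E t) \<langle>\<Psi> t, \<Psi> s\<rangle> = \<langle>\<Psi> t, (h s - h t) \<Psi> s\<rangle>\<close>, so only continuity of \<open>\<Psi>\<close> is needed.
\<close>

lemma hellmann_feynman:
  assumes t: "\<bar>t\<bar> < r"
  shows "(E has_real_derivative
           Re (ip (\<Psi> t) (kernel_apply X (h' t) (\<Psi> t)) / ip (\<Psi> t) (\<Psi> t))) (at t)"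
proof -
  have key: "of_real (E s - E t) * ip (\<Psi> t) (\<Psi> s) = ip (\<Psi> t) (\<lambda>S. ap s (\<Psi> s) S - ap t (\<Psi> s) S)"
    if s: "\<bar>s\<bar> < r" for s
  proof -
    have 1: "ip (\<Psi> t) (ap s (\<Psi> s)) = of_real (E s) * ip (\<Psi> t) (\<Psi> s)"
      unfolding inner_on_scale_right[symmetric] using \<Psi>(1)[OF s] by (intro inner_on_cong) auto
    have "ip (\<Psi> t) (ap t (\<Psi> s)) = ip (ap t (\<Psi> t)) (\<Psi> s)"
      by (rule inner_kernel_apply_hermitian[OF hermitian, symmetric])
    also have "\<dots> = ip (\<lambda>S. of_real (E t) * \<Psi> t S) (\<Psi> s)"
      using \<Psi>(1)[OF t] by (intro inner_on_cong) auto
    also have "\<dots> = of_real (E t) * ip (\<Psi> t) (\<Psi> s)"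
      by (simp add: inner_on_def sum_distrib_left mult.assoc)
    finally show ?thesis
      using 1 by (simp add: inner_on_diff_right algebra_simps)
  qed
  have ip_lim: "((\<lambda>s. ip (\<Psi> t) (\<Psi> s)) \<longlongrightarrow> ip (\<Psi> t) (\<Psi> t)) (at t)"
    unfolding inner_on_def by (intro tendsto_intros \<Psi>_tendsto t)
  have ip_ne: "ip (\<Psi> t) (\<Psi> t) \<noteq> 0"
    using \<Psi>_norm[OF t] by (simp add: inner_on_self)
  have q: "((\<lambda>s. (h s S T - h t S T) / of_real (s - t)) \<longlongrightarrow> h' t S T) (at t)"
    if "S \<in> X" "T \<in> X" for S T
    using that deriv by (intro has_vector_derivative_imp_tendsto) auto
  have "((\<lambda>s. (\<Sum>S\<in>X. \<Sum>T\<in>X. cnj (\<Psi> t S) * ((h s S T - h t S T) / of_real (s - t)) * \<Psi> s T)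
        / ip (\<Psi> t) (\<Psi> s)) \<longlongrightarrow>
      (\<Sum>S\<in>X. \<Sum>T\<in>X. cnj (\<Psi> t S) * h' t S T * \<Psi> t T) / ip (\<Psi> t) (\<Psi> t)) (at t)"
    by (intro tendsto_intros \<Psi>_tendsto t q ip_lim ip_ne)
  then have lim: "((\<lambda>s. Re ((\<Sum>S\<in>X. \<Sum>T\<in>X. cnj (\<Psi> t S) * ((h s S T - h t S T) / of_real (s - t)) * \<Psi> s T)
        / ip (\<Psi> t) (\<Psi> s))) \<longlongrightarrow>
      Re (ip (\<Psi> t) (kernel_apply X (h' t) (\<Psi> t)) / ip (\<Psi> t) (\<Psi> t))) (at t)"
    unfolding inner_kernel_apply by (rule tendsto_Re)
  \<comment> \<open>The overlap tends to the squared norm of \<open>\<Psi> t\<close>, so dividing by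
    it is legitimate near \<open>t\<close>.\<close>
  have "\<forall>\<^sub>F s in at t. ip (\<Psi> t) (\<Psi> s) \<noteq> 0"
    using tendsto_imp_eventually_ne[OF ip_lim ip_ne] .
  then have "\<forall>\<^sub>F s in at t. Re ((\<Sum>S\<in>X. \<Sum>T\<in>X. cnj (\<Psi> t S) * ((h s S T - h t S T) / of_real (s - t)) * \<Psi> s T)
        / ip (\<Psi> t) (\<Psi> s)) = (E s - E t) / (s - t)"
    using near[OF t] eventually_neq_at_within[of t]
  proof eventually_elim
    case (elim s)
    have "(\<Sum>S\<in>X. \<Sum>T\<in>X. cnj (\<Psi> t S) * ((h s S T - h t S T) / of_real (s - t)) * \<Psi> s T)
      = ip (\<Psi> t) (\<lambda>S. ap s (\<Psi> s) S - ap t (\<Psi> s) S) / of_real (s - t)"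
      unfolding kernel_apply_diff_kernel[symmetric] inner_kernel_apply
      by (simp add: sum_divide_distrib)
    also have "\<dots> = of_real ((E s - E t) / (s - t)) * ip (\<Psi> t) (\<Psi> s)"
      unfolding key[OF elim(2), symmetric] by simp
    finally show ?case using elim(1) by simp
  qed
  with lim show ?thesis
    unfolding has_field_derivative_iff by (rule Lim_transform_eventually)
qed

lemma deriv_E:
  "\<bar>t\<bar> < r \<Longrightarrow> deriv E t = Re (ip (\<Psi> t) (kernel_apply X (h' t) (\<Psi> t)) / ip (\<Psi> t) (\<Psi> t))"
  by (rule DERIV_imp_deriv) (rule hellmann_feynman)

lemma differentiable_E: "\<forall>\<^sub>F t in nhds 0. E differentiable at t"
proof -
  have "\<forall>\<^sub>F t in nhds 0. t \<in> {-r<..<r}"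
    using r_pos by (intro eventually_nhds_in_open) auto
  then show ?thesis
    by eventually_elim (use hellmann_feynman real_differentiable_def in \<open>fastforce simp: abs_less_iff\<close>)
qed

lemma deriv_E_0: "deriv E 0 = 0"
proof -
  have "ip (\<Psi> 0) (kernel_apply X (h' 0) (\<Psi> 0)) = ip e (kernel_apply X (h' 0) e)"
    unfolding inner_kernel_apply by (intro sum.cong refl) (simp add: \<Psi>_0)
  also have "\<dots> = 0"
    using h'_e by (simp add: inner_on_def)
  finally show ?thesis
    using deriv_E[of 0] r_pos by simp
qed

text \<open>
  The paramagnetic term vanishes: in \<open>h' t (\<Psi> t) = h' t e + h' t (\<Psi> t - e)\<close> the second summand,
  paired with \<open>\<Psi> t\<close>, is \<open>o(t)\<close>, because \<open>\<Psi> t - e = O(t)\<close> and \<open>h' t (\<Psi> t)\<close> tends to \<open>h' 0 e = 0\<close>.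
\<close>

lemma second_derivative:
  "(deriv E has_real_derivative Re (ip e (kernel_apply X h'' e)) / (nm e)\<^sup>2) (at 0)"
proof -
  have r0: "\<bar>0\<bar> < r" using r_pos by simp
  have \<Psi>_lim: "((\<lambda>s. \<Psi> s S) \<longlongrightarrow> e S) (at 0)" if "S \<in> X" for S
    using \<Psi>_tendsto[OF r0 that] by (simp add: \<Psi>_0[OF that])
  have ip_lim: "((\<lambda>s. ip (\<Psi> s) (\<Psi> s)) \<longlongrightarrow> ip e e) (at 0)"
    unfolding inner_on_def by (intro tendsto_intros \<Psi>_lim)
  have ip_ne: "ip e e \<noteq> 0"
    using norm_e by (simp add: inner_on_self)
  \<comment> \<open>\<open>F\<close> and \<open>G\<close> are the two summands divided by
    \<open>s\<close>. Since \<open>h' 0\<close> kills \<open>e\<close>, subtracting it in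
    \<open>F\<close> is free and creates a difference quotient; in \<open>G\<close> hermiticity has
    moved \<open>h' s\<close> onto the left factor.\<close>
  define F where "F s = (\<Sum>S\<in>X. cnj (\<Psi> s S) * (\<Sum>T\<in>X. (h' s S T - h' 0 S T) / of_real s * e T))" for s :: real
  define G where "G s = (\<Sum>S\<in>X. cnj (\<Sum>T\<in>X. h' s S T * \<Psi> s T) * ((\<Psi> s S - e S) / of_real s))" for s :: real
  have "(F \<longlongrightarrow> (\<Sum>S\<in>X. cnj (e S) * (\<Sum>T\<in>X. h'' S T * e T))) (at 0)"
    unfolding F_def using has_vector_derivative_imp_tendsto[OF deriv']
    by (intro tendsto_intros \<Psi>_lim) simp_all
  then have F: "(F \<longlongrightarrow> ip e (kernel_apply X h'' e)) (at 0)"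
    by (simp add: inner_on_def kernel_apply_def)
  have h'_lim: "((\<lambda>s. h' s S T) \<longlongrightarrow> h' 0 S T) (at 0)" if "S \<in> X" "T \<in> X" for S T
    using has_vector_derivative_continuous[OF deriv'[OF that]] by (simp add: isCont_def continuous_within)
  have G: "(G \<longlongrightarrow> 0) (at 0)"
    unfolding G_def
  proof (rule tendsto_null_sum)
    fix S assume S: "S \<in> X"
    have "((\<lambda>s. cnj (\<Sum>T\<in>X. h' s S T * \<Psi> s T)) \<longlongrightarrow> cnj (\<Sum>T\<in>X. h' 0 S T * e T)) (at 0)"
      by (intro tendsto_intros \<Psi>_lim h'_lim S)
    then have "((\<lambda>s. cnj (\<Sum>T\<in>X. h' s S T * \<Psi> s T)) \<longlongrightarrow> 0) (at 0)"
      using h'_e[OF S] by (simp only: kernel_apply_def complex_cnj_zero)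
    then have lim: "((\<lambda>s. cmod (cnj (\<Sum>T\<in>X. h' s S T * \<Psi> s T)) * D) \<longlongrightarrow> 0) (at 0)"
      using tendsto_mult_left_zero tendsto_norm_zero by blast
    have bound: "\<forall>\<^sub>F s in at 0. cmod ((\<Psi> s S - e S) / of_real s) \<le> D"
      using near[OF r0] eventually_neq_at_within[of 0]
    proof eventually_elim
      case (elim s)
      then show ?case
        using \<Psi>_lipschitz[OF elim(1) r0 S] by (simp add: \<Psi>_0[OF S] norm_divide field_simps)
    qed
    show "((\<lambda>s. cnj (\<Sum>T\<in>X. h' s S T * \<Psi> s T) * ((\<Psi> s S - e S) / of_real s)) \<longlongrightarrow> 0) (at 0)"
    proof (rule Lim_null_comparison[OF _ lim])
      show "\<forall>\<^sub>F s in at 0. cmod (cnj (\<Sum>T\<in>X. h' s S T * \<Psi> s T) * ((\<Psi> s S - e S) / of_real s))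
        \<le> cmod (cnj (\<Sum>T\<in>X. h' s S T * \<Psi> s T)) * D"
        using bound by eventually_elim (simp only: norm_mult mult_left_mono norm_ge_zero)
    qed
  qed
  have "((\<lambda>s. Re ((F s + G s) / ip (\<Psi> s) (\<Psi> s))) \<longlongrightarrow>
      Re ((ip e (kernel_apply X h'' e) + 0) / ip e e)) (at 0)"
    by (intro tendsto_intros F G ip_lim ip_ne)
  also have "Re ((ip e (kernel_apply X h'' e) + 0) / ip e e) = Re (ip e (kernel_apply X h'' e)) / (nm e)\<^sup>2"
    unfolding inner_on_self by (simp only: add_0_right Re_divide_of_real)
  finally have lim: "((\<lambda>s. Re ((F s + G s) / ip (\<Psi> s) (\<Psi> s))) \<longlongrightarrow>
      Re (ip e (kernel_apply X h'' e)) / (nm e)\<^sup>2) (at 0)" .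
  have "\<forall>\<^sub>F s in at 0. Re ((F s + G s) / ip (\<Psi> s) (\<Psi> s)) = (deriv E s - deriv E 0) / (s - 0)"
    using near[OF r0] eventually_neq_at_within[of 0]
  proof eventually_elim
    case (elim s)
    have h'0: "(\<Sum>T\<in>X. (h' s S T - h' 0 S T) / of_real s * e T) = kernel_apply X (h' s) e S / of_real s"
      if "S \<in> X" for S
    proof -
      have "(\<Sum>T\<in>X. (h' s S T - h' 0 S T) / of_real s * e T) =
        (kernel_apply X (h' s) e S - kernel_apply X (h' 0) e S) / of_real s"
        by (simp add: kernel_apply_def sum_subtractf sum_divide_distrib diff_divide_distrib algebra_simps)
      then show ?thesis using h'_e[OF that] by simp
    qed
    have "F s = ip (\<Psi> s) (kernel_apply X (h' s) e) / of_real s"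
      unfolding F_def inner_on_def sum_divide_distrib by (intro sum.cong refl) (simp only: h'0 times_divide_eq_right)
    moreover have "G s = ip (kernel_apply X (h' s) (\<Psi> s)) (\<lambda>S. \<Psi> s S - e S) / of_real s"
      by (simp add: G_def inner_on_def sum_divide_distrib kernel_apply_def)
    then have "G s = (ip (\<Psi> s) (kernel_apply X (h' s) (\<Psi> s)) - ip (\<Psi> s) (kernel_apply X (h' s) e)) / of_real s"
      unfolding inner_kernel_apply_hermitian[OF hermitian'] kernel_apply_diff inner_on_diff_right .
    ultimately have "F s + G s = ip (\<Psi> s) (kernel_apply X (h' s) (\<Psi> s)) / of_real s"
      by (simp add: diff_divide_distrib)
    then have "(F s + G s) / ip (\<Psi> s) (\<Psi> s)
      = ip (\<Psi> s) (kernel_apply X (h' s) (\<Psi> s)) / ip (\<Psi> s) (\<Psi> s) / of_real s"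
      by simp
    then show ?case
      unfolding deriv_E[OF elim(1)] deriv_E_0 by (simp only: Re_divide_of_real diff_zero)
  qed
  with lim show ?thesis
    unfolding has_field_derivative_iff by (rule Lim_transform_eventually)
qed

end

section \<open>Quartet operators in the occupation basis\<close>

definition cell_modes :: "cell \<Rightarrow> mode set" where
  "cell_modes R = {R} \<times> {1..4}"

definition movable :: "cell \<Rightarrow> cell \<Rightarrow> mode set \<Rightarrow> bool" where
  "movable R R' S \<longleftrightarrow> cell_modes R \<subseteq> S \<and> cell_modes R' \<inter> S = {}"

text \<open>A hop is encoded as a global involution on configurations instead of a removal followed
  by an insertion, so sums can be reindexed by it and hermiticity is immediate. On movable
  configurations both descriptions agree.\<close>

definition swap_cells :: "cell \<Rightarrow> cell \<Rightarrow> mode set \<Rightarrow> mode set" where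
  "swap_cells R R' S = map_prod (Transposition.transpose R R') id ` S"

lemma cell_modes_eq: "cell_modes R = {(R, 1), (R, 2), (R, 3), (R, 4)}"
  by (auto simp: cell_modes_def)

lemma mem_swap_cells: "(Q, m) \<in> swap_cells R R' S \<longleftrightarrow> (Transposition.transpose R R' Q, m) \<in> S"
  by (force simp: swap_cells_def image_iff)

lemma swap_cells_involutory [simp]: "swap_cells R R' (swap_cells R R' S) = S"
  by (auto simp: mem_swap_cells)

lemma swap_cells_commute: "swap_cells R R' = swap_cells R' R"
  by (simp add: swap_cells_def fun_eq_iff transpose_commute)

lemma card_swap_cells [simp]: "card (swap_cells R R' S) = card S"
  unfolding swap_cells_def
  by (rule card_image) (auto intro!: inj_on_subset[OF prod.inj_map[OF inj_transpose inj_on_id]])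

lemma swap_cells_subset_modes:
  assumes "R \<in> cells d L" "R' \<in> cells d L"
  shows "swap_cells R R' S \<subseteq> modes d L \<longleftrightarrow> S \<subseteq> modes d L"
proof -
  have *: "swap_cells R R' S \<subseteq> modes d L" if "S \<subseteq> modes d L" for S
    using that assms by (auto simp: swap_cells_def modes_def Transposition.transpose_def subset_iff)
  show ?thesis
    using *[of S] *[of "swap_cells R R' S"] by auto
qed

lemma movable_swap_cells: "movable R R' (swap_cells R R' S) \<longleftrightarrow> movable R' R S"
  by (auto simp: movable_def cell_modes_eq mem_swap_cells)

lemma swap_cells_movable:
  assumes "movable R R' S" "S \<subseteq> UNIV \<times> {1..4}"
  shows "swap_cells R R' S = (S - cell_modes R) \<union> cell_modes R'"
proof -
  have "R \<noteq> R'" using assms by (auto simp: movable_def cell_modes_eq)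
  show ?thesis
  proof (intro set_eqI, clarify)
    fix Q m
    show "(Q, m) \<in> swap_cells R R' S \<longleftrightarrow> (Q, m) \<in> (S - cell_modes R) \<union> cell_modes R'"
      using assms \<open>R \<noteq> R'\<close>
      by (cases "Q = R"; cases "Q = R'") (auto simp: mem_swap_cells movable_def cell_modes_def)
  qed
qed

text \<open>
  The modes of a cell have consecutive keys, so they all carry the sign determined by the modes
  of the other cells; the four signs of a quartet operator multiply to \<open>1\<close>.
\<close>

lemma jw_sign_cell:
  assumes "T \<subseteq> UNIV \<times> {1..4}" "cell_modes R \<inter> T = {}" "B \<subseteq> {R} \<times> {m..}" "m \<in> {1..4}"
  shows "jw_sign (R, m) (T \<union> B) = jw_sign (R, 1) T"
proof -
  have "mode_key i < mode_key (R, m) \<longleftrightarrow> mode_key i < mode_key (R, 1)" if "i \<in> T" for i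
  proof -
    obtain Q n where i: "i = (Q, n)" by fastforce
    have "n \<in> {1..4}" "Q \<noteq> R"
      using assms that i by (auto simp: cell_modes_def)
    then have "n \<in> {1..4}" "to_nat Q \<noteq> to_nat R" by auto
    with assms(4) have "4 * to_nat Q + n < 4 * to_nat R + m \<longleftrightarrow> 4 * to_nat Q + n < 4 * to_nat R + 1"
      by (cases rule: linorder_cases[of "to_nat Q" "to_nat R"]) auto
    then show ?thesis
      by (simp add: mode_key_def i)
  qed
  moreover have "\<not> mode_key i < mode_key (R, m)" if "i \<in> B" for i
    using assms(3) that by (auto simp: mode_key_def)
  ultimately have "{i \<in> T \<union> B. mode_key i < mode_key (R, m)} = {i \<in> T. mode_key i < mode_key (R, 1)}"
    by blast
  then show ?thesis by (simp add: jw_sign_def)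
qed

lemma quartet_create_apply:
  assumes "S \<subseteq> UNIV \<times> {1..4}"
  shows "quartet_create R \<psi> S = (if cell_modes R \<subseteq> S then \<psi> (S - cell_modes R) else 0)"
proof (cases "cell_modes R \<subseteq> S")
  case True
  define T where "T = S - cell_modes R"
  have T: "T \<subseteq> UNIV \<times> {1..4}" "cell_modes R \<inter> T = {}"
    using assms by (auto simp: T_def)
  note sign = jw_sign_cell[OF T]
  \<comment> \<open>The outermost factor acts on the argument first: labels leave in the order 1, 2,
    3, 4, so the modes of the cell still present never precede the one whose sign is read.\<close>
  have sets: "S = T \<union> {(R, 1), (R, 2), (R, 3), (R, 4)}"
    "S - {(R, 1)} = T \<union> {(R, 2), (R, 3), (R, 4)}"
    "S - {(R, 1)} - {(R, 2)} = T \<union> {(R, 3), (R, 4)}"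
    "S - {(R, 1)} - {(R, 2)} - {(R, 3)} = T \<union> {(R, 4)}"
    "S - {(R, 1)} - {(R, 2)} - {(R, 3)} - {(R, 4)} = T"
    using True by (auto simp: T_def cell_modes_eq)
  have "jw_sign (R, 1) S = jw_sign (R, 1) T"
    unfolding sets(1) by (rule sign) auto
  moreover have "jw_sign (R, 2) (S - {(R, 1)}) = jw_sign (R, 1) T"
    unfolding sets(2) by (rule sign) auto
  moreover have "jw_sign (R, 3) (S - {(R, 1)} - {(R, 2)}) = jw_sign (R, 1) T"
    unfolding sets(3) by (rule sign) auto
  moreover have "jw_sign (R, 4) (S - {(R, 1)} - {(R, 2)} - {(R, 3)}) = jw_sign (R, 1) T"
    unfolding sets(4) by (rule sign) auto
  ultimately have "quartet_create R \<psi> S = \<psi> T"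
    using True by (simp add: quartet_create_def create_def cell_modes_eq sets(5)[simplified])
  then show ?thesis using True by (simp add: T_def)
next
  case False
  then show ?thesis
    by (auto simp: quartet_create_def create_def cell_modes_eq)
qed

lemma quartet_annihilate_apply:
  assumes "S \<subseteq> UNIV \<times> {1..4}"
  shows "quartet_annihilate R \<psi> S = (if cell_modes R \<inter> S = {} then \<psi> (S \<union> cell_modes R) else 0)"
proof (cases "cell_modes R \<inter> S = {}")
  case True
  note sign = jw_sign_cell[OF assms True]
  \<comment> \<open>Labels enter in the order 4, 3, 2, 1, so again the modes already added come
    after the one whose sign is read.\<close>
  have sets: "S = S \<union> {}" "insert (R, 4) S = S \<union> {(R, 4)}"
    "insert (R, 3) (insert (R, 4) S) = S \<union> {(R, 3), (R, 4)}"
    "insert (R, 2) (insert (R, 3) (insert (R, 4) S)) = S \<union> {(R, 2), (R, 3), (R, 4)}"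
    "insert (R, 1) (insert (R, 2) (insert (R, 3) (insert (R, 4) S))) = S \<union> cell_modes R"
    by (auto simp: cell_modes_eq)
  have "jw_sign (R, 4) S = jw_sign (R, 1) S"
    using sign[of "{}" 4] by simp
  moreover have "jw_sign (R, 3) (insert (R, 4) S) = jw_sign (R, 1) S"
    unfolding sets(2) by (rule sign) auto
  moreover have "jw_sign (R, 2) (insert (R, 3) (insert (R, 4) S)) = jw_sign (R, 1) S"
    unfolding sets(3) by (rule sign) auto
  moreover have "jw_sign (R, 1) (insert (R, 2) (insert (R, 3) (insert (R, 4) S))) = jw_sign (R, 1) S"
    unfolding sets(4) by (rule sign) auto
  ultimately have "quartet_annihilate R \<psi> S =
      \<psi> (insert (R, 1) (insert (R, 2) (insert (R, 3) (insert (R, 4) S))))"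
    using True by (simp add: quartet_annihilate_def annihilate_def cell_modes_eq)
  then show ?thesis using True sets(5) by simp
next
  case False
  then show ?thesis
    by (auto simp: quartet_annihilate_def annihilate_def cell_modes_eq)
qed

lemma create_fock: "k \<in> modes d L \<Longrightarrow> \<psi> \<in> fock d L \<Longrightarrow> create k \<psi> \<in> fock d L"
  by (auto simp: fock_def create_def split: if_splits)

lemma annihilate_fock: "k \<in> modes d L \<Longrightarrow> \<psi> \<in> fock d L \<Longrightarrow> annihilate k \<psi> \<in> fock d L"
  by (auto simp: fock_def annihilate_def split: if_splits)

lemma quartet_hop_fock:
  assumes "R \<in> cells d L" "R' \<in> cells d L" "\<psi> \<in> fock d L"
  shows "quartet_create R (quartet_annihilate R' \<psi>) \<in> fock d L"
  using assms unfolding quartet_create_def quartet_annihilate_def comp_def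
  by (intro create_fock annihilate_fock) (auto simp: modes_def)

text \<open>Operators act on amplitudes, so \<open>S\<close> is the configuration after the hop from
  \<open>R'\<close> to \<open>R\<close>: there \<open>R\<close> is full and \<open>R'\<close> empty,
  and the swapped set is the configuration before.\<close>

lemma quartet_hop_apply:
  assumes "R \<in> cells d L" "R' \<in> cells d L" "R \<noteq> R'" "\<psi> \<in> fock d L"
  shows "quartet_create R (quartet_annihilate R' \<psi>) S =
    of_bool (movable R R' S) * \<psi> (swap_cells R R' S)"
proof (cases "S \<subseteq> modes d L")
  case True
  then have S: "S \<subseteq> UNIV \<times> {1..4}" by (auto simp: modes_def)
  then have "S - cell_modes R \<subseteq> UNIV \<times> {1..4}" by auto
  moreover have "cell_modes R' \<inter> (S - cell_modes R) = cell_modes R' \<inter> S"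
    using assms(3) by (auto simp: cell_modes_def)
  ultimately show ?thesis
    using S swap_cells_movable[of R R' S]
    by (auto simp: quartet_create_apply quartet_annihilate_apply movable_def)
next
  \<comment> \<open>The sign computation needs labels from 1 to 4. Outside the lattice both sides
    vanish instead, as swapping lattice cells cannot bring a configuration back into it.\<close>
  case False
  then have "\<not> swap_cells R R' S \<subseteq> modes d L"
    by (simp add: swap_cells_subset_modes assms)
  then have "\<psi> (swap_cells R R' S) = 0" "quartet_create R (quartet_annihilate R' \<psi>) S = 0"
    using False quartet_hop_fock[OF assms(1,2,4)] assms(4) unfolding fock_def by blast+
  then show ?thesis by simp
qed

lemma num_apply: "num R m \<psi> S = (if (R, m) \<in> S then \<psi> S else 0)"
  by (auto simp: num_def create_def annihilate_def insert_absorb)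

lemma proj_empty_apply: "proj_empty R \<psi> S = of_bool (cell_modes R \<inter> S = {}) * \<psi> S"
  by (auto simp: proj_empty_def num_apply cell_modes_eq)

lemma proj_full_apply: "proj_full R \<psi> S = of_bool (cell_modes R \<subseteq> S) * \<psi> S"
  by (auto simp: proj_full_def num_apply cell_modes_eq)

lemma proj_quartet_apply:
  "proj_quartet R \<psi> S = of_bool (cell_modes R \<subseteq> S \<or> cell_modes R \<inter> S = {}) * \<psi> S"
  by (auto simp: proj_quartet_def proj_empty_apply proj_full_apply cell_modes_eq)

text \<open>The projectors and the transfers carry the same indicators, which makes the bond a
  discrete Laplacian on configurations. This is the source of positivity and of the flat ground
  state.\<close>

lemma bond_term_apply:
  assumes "R \<in> cells d L" "R' \<in> cells d L" "R \<noteq> R'" "\<psi> \<in> fock d L"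
  shows "bond_term R R' \<psi> S =
    (of_bool (movable R R' S) + of_bool (movable R' R S)) / 2 * (\<psi> S - \<psi> (swap_cells R R' S))"
  using assms
  by (simp add: bond_term_def op_scale_def quartet_hop_apply[of _ d L] proj_empty_apply
      proj_full_apply movable_def swap_cells_commute[of R' R] of_bool_conj algebra_simps diff_divide_distrib add_divide_distrib)

lemma sum_operator_apply: "(\<Sum>x\<in>A. F x) \<psi> S = (\<Sum>x\<in>A. F x \<psi> S)" for F :: "'a \<Rightarrow> operator"
  by (induction A rule: infinite_finite_induct) auto

text \<open>The total number operator multiplies the amplitude at \<open>S\<close> by
  \<open>card S\<close>, so the eigenvalue equation restricts the support.\<close>

lemma sector_iff:
  "\<psi> \<in> sector d L n \<longleftrightarrow> (\<forall>S. \<psi> S \<noteq> 0 \<longrightarrow> S \<subseteq> modes d L \<and> card S = n)"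
proof -
  have total: "total_num d L \<psi> S = of_nat (card S) * \<psi> S" if "S \<subseteq> modes d L" for S
  proof -
    have "total_num d L \<psi> S = (\<Sum>R\<in>cells d L. \<Sum>m\<in>{1..4}. if (R, m) \<in> S then \<psi> S else 0)"
      by (simp add: total_num_def sum_operator_apply num_apply)
    also have "\<dots> = (\<Sum>k\<in>modes d L. if k \<in> S then \<psi> S else 0)"
      by (simp add: modes_def sum.cartesian_product)
    also have "\<dots> = (\<Sum>k\<in>S. \<psi> S)"
      using that by (simp add: sum.If_cases[OF finite_modes] Int_absorb1)
    finally show ?thesis by simp
  qed
  have zero: "total_num d L \<psi> S = 0" if "\<psi> S = 0" for S
    unfolding total_num_def sum_operator_apply num_apply using that by (intro sum.neutral ballI) simp
  have "total_num d L \<psi> S = of_nat n * \<psi> S \<longleftrightarrow> (\<psi> S \<noteq> 0 \<longrightarrow> card S = n)"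
    if "\<psi> S \<noteq> 0 \<longrightarrow> S \<subseteq> modes d L" for S
    using that total[of S] zero[of S] by (cases "\<psi> S = 0") auto
  then show ?thesis
    unfolding sector_def fock_def fun_eq_iff by blast
qed

section \<open>Transpositions and connectedness of the lattice\<close>

text \<open>Deleting \<open>x\<close> matches these sets with the subsets of size
  \<open>M - 1\<close> that avoid both points.\<close>

lemma card_subsets_separating:
  assumes "finite V" "x \<in> V" "y \<in> V" "x \<noteq> y" "0 < M"
  shows "card {A. A \<subseteq> V \<and> card A = M \<and> x \<in> A \<and> y \<notin> A} = (card V - 2) choose (M - 1)"
proof -
  have "bij_betw (insert x) {B. B \<subseteq> V - {x, y} \<and> card B = M - 1}
      {A. A \<subseteq> V \<and> card A = M \<and> x \<in> A \<and> y \<notin> A}"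
  proof (rule bij_betw_byWitness[where f' = "\<lambda>A. A - {x}"])
    show "insert x ` {B. B \<subseteq> V - {x, y} \<and> card B = M - 1}
        \<subseteq> {A. A \<subseteq> V \<and> card A = M \<and> x \<in> A \<and> y \<notin> A}"
    proof (clarify, intro conjI)
      fix B assume B: "B \<subseteq> V - {x, y}" "card B = M - 1"
      then have "finite B" "x \<notin> B" using assms(1) finite_subset by auto
      then show "card (insert x B) = M" using B assms(5) by simp
    qed (use assms in auto)
    show "(\<lambda>A. A - {x}) ` {A. A \<subseteq> V \<and> card A = M \<and> x \<in> A \<and> y \<notin> A}
        \<subseteq> {B. B \<subseteq> V - {x, y} \<and> card B = M - 1}"
      by auto
  qed auto
  then have "card {A. A \<subseteq> V \<and> card A = M \<and> x \<in> A \<and> y \<notin> A} =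
      card {B. B \<subseteq> V - {x, y} \<and> card B = M - 1}"
    by (simp add: bij_betw_same_card)
  also have "\<dots> = card (V - {x, y}) choose (M - 1)"
    using assms(1) by (intro n_subsets) auto
  also have "card (V - {x, y}) = card V - 2"
    using assms by (subst card_Diff_subset) auto
  finally show ?thesis .
qed

text \<open>Both sides count the subsets of size \<open>M\<close> with a marked member and a marked
  nonmember; the proof applies two absorption identities.\<close>

lemma choose_minus_two:
  assumes "0 < M" "M < N"
  shows "real (N * (N - 1)) * real ((N - 2) choose (M - 1)) = real M * real (N - M) * real (N choose M)"
proof -
  have 1: "M * (N choose M) = N * ((N - 1) choose (M - 1))"
    using times_binomial_minus1_eq[OF assms(1)] .
  have 2: "(N - 1) * ((N - 2) choose (M - 1)) = (N - M) * ((N - 1) choose (M - 1))"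
    using binomial_absorb_comp[of "N - 1" "M - 1"] assms by (simp add: numeral_2_eq_2)
  have "(N * (N - 1)) * ((N - 2) choose (M - 1)) = M * (N - M) * (N choose M)"
    using arg_cong[OF 1, of "\<lambda>x. (N - M) * x"] arg_cong[OF 2, of "\<lambda>x. N * x"]
    by (simp add: algebra_simps)
  then show ?thesis by (metis of_nat_mult)
qed

text \<open>
  The pairs of points whose transposition leaves \<open>f\<close> invariant form an equivalence relation,
  because a transposition of \<open>x\<close> and \<open>z\<close> is conjugate to one of \<open>y\<close> and \<open>z\<close>.
\<close>

definition swap_invariant :: "'a set \<Rightarrow> nat \<Rightarrow> ('a set \<Rightarrow> 'b) \<Rightarrow> 'a \<Rightarrow> 'a \<Rightarrow> bool" where
  "swap_invariant V M f x y \<longleftrightarrow>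
     (\<forall>A. A \<subseteq> V \<longrightarrow> card A = M \<longrightarrow> f (Transposition.transpose x y ` A) = f A)"

lemma transpose_image_subset:
  "x \<in> V \<Longrightarrow> y \<in> V \<Longrightarrow> A \<subseteq> V \<Longrightarrow> Transposition.transpose x y ` A \<subseteq> V"
  by (auto simp: Transposition.transpose_def)

lemma card_transpose_image: "card (Transposition.transpose x y ` A) = card A"
  by (rule card_image) (rule inj_on_subset[OF inj_transpose], simp)

lemma swap_invariant_refl: "swap_invariant V M f x x"
  by (simp add: swap_invariant_def)

lemma swap_invariant_sym: "swap_invariant V M f x y \<Longrightarrow> swap_invariant V M f y x"
  by (simp add: swap_invariant_def transpose_commute)

lemma swap_invariant_trans:
  assumes V: "x \<in> V" "y \<in> V" "z \<in> V"
    and xy: "swap_invariant V M f x y" and yz: "swap_invariant V M f y z"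
  shows "swap_invariant V M f x z"
proof (cases "x = z \<or> x = y \<or> y = z")
  case True
  then show ?thesis using xy yz swap_invariant_refl by auto
next
  case False
  let ?xy = "Transposition.transpose x y" and ?yz = "Transposition.transpose y z"
  have eq: "Transposition.transpose x z ` A = ?xy ` ?yz ` ?xy ` A" for A
    unfolding image_image using False by (intro image_cong refl) (auto simp: Transposition.transpose_def)
  show ?thesis
    unfolding swap_invariant_def
  proof (intro allI impI)
    fix A assume A: "A \<subseteq> V" "card A = M"
    have A1: "?xy ` A \<subseteq> V" "card (?xy ` A) = M"
      using A V by (simp_all add: transpose_image_subset card_transpose_image)
    have A2: "?yz ` ?xy ` A \<subseteq> V" "card (?yz ` ?xy ` A) = M"
      using A1 V by (simp_all add: transpose_image_subset card_transpose_image)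
    have "f (?xy ` ?yz ` ?xy ` A) = f (?yz ` ?xy ` A)"
      using xy A2 unfolding swap_invariant_def by blast
    also have "\<dots> = f (?xy ` A)"
      using yz A1 unfolding swap_invariant_def by blast
    also have "\<dots> = f A"
      using xy A unfolding swap_invariant_def by blast
    finally show "f (Transposition.transpose x z ` A) = f A" unfolding eq .
  qed
qed

text \<open>Exchanging a point of \<open>A - B\<close> with one of \<open>B - A\<close> shrinks
  \<open>A - B\<close>; equal cardinalities ensure that the second point exists.\<close>

lemma swap_invariant_imp_constant:
  assumes "finite V" and inv: "\<And>x y. x \<in> V \<Longrightarrow> y \<in> V \<Longrightarrow> swap_invariant V M f x y"
    and A: "A \<subseteq> V" "card A = M" and B: "B \<subseteq> V" "card B = M"
  shows "f A = f B"
  using A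
proof (induction "card (A - B)" arbitrary: A)
  case 0
  have fin: "finite A" "finite B" using 0 B assms(1) finite_subset by auto
  then have "A \<subseteq> B" using 0 by simp
  then have "A = B" using card_subset_eq[OF fin(2)] 0 B by simp
  then show ?case by simp
next
  case (Suc n)
  have fin: "finite A" "finite B" using Suc B assms(1) finite_subset by auto
  then obtain x where x: "x \<in> A" "x \<notin> B"
    using Suc(2) by (metis Diff_iff card.empty equals0I nat.distinct(1))
  have "B - A \<noteq> {}"
  proof
    assume "B - A = {}"
    then have "B = A" using card_subset_eq[OF fin(1)] Suc B by simp
    then show False using x by simp
  qed
  then obtain y where y: "y \<in> B" "y \<notin> A" by blast
  let ?A = "Transposition.transpose x y ` A"
  have V: "x \<in> V" "y \<in> V" using x y Suc B by auto
  have "?A = insert y (A - {x})"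
    using x y by (force simp: Transposition.transpose_def image_iff)
  then have "?A - B = (A - B) - {x}" using x y by auto
  then have "n = card (?A - B)" using Suc(2) x fin by simp
  then have "f ?A = f B"
    using Suc V by (intro Suc(1)) (simp_all add: transpose_image_subset card_transpose_image)
  moreover have "f ?A = f A"
    using inv[OF V] Suc unfolding swap_invariant_def by blast
  ultimately show ?case by simp
qed

text \<open>Every cell is joined to the origin by setting its coordinates to 0 in turn. The relation
  is left abstract so that swap invariance, transitive only among cells of the lattice, can be
  inserted.\<close>

lemma shift_connected:
  assumes L: "0 < L" and R: "R \<in> cells d L" and Q: "Q \<in> cells d L"
    and step: "\<And>R \<mu>. R \<in> cells d L \<Longrightarrow> \<mu> < d \<Longrightarrow> P R (shift L \<mu> R)"
    and refl: "\<And>R. P R R" and sym: "\<And>R Q. P R Q \<Longrightarrow> P Q R"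
    and trans: "\<And>R Q S. R \<in> cells d L \<Longrightarrow> Q \<in> cells d L \<Longrightarrow> S \<in> cells d L \<Longrightarrow> P R Q \<Longrightarrow> P Q S \<Longrightarrow> P R S"
  shows "P R Q"
proof -
  have upd: "R[\<mu> := v] \<in> cells d L" if "R \<in> cells d L" "v < L" for R \<mu> v
    using that set_update_subset_insert[of R \<mu> v] by (auto simp: cells_def)
  have shifts: "P R (R[\<mu> := (R ! \<mu> + k) mod L])" if R: "R \<in> cells d L" "\<mu> < d" for R \<mu> k
  proof (induction k)
    case 0
    have "R ! \<mu> < L" using R by (auto simp: cells_def subset_iff)
    then show ?case by (simp add: refl)
  next
    case (Suc k)
    let ?S = "R[\<mu> := (R ! \<mu> + k) mod L]"
    have S: "?S \<in> cells d L" "R[\<mu> := (R ! \<mu> + Suc k) mod L] \<in> cells d L"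
      using upd R L by simp_all
    have "shift L \<mu> ?S = R[\<mu> := (R ! \<mu> + Suc k) mod L]"
      using R by (simp add: shift_def cells_def mod_Suc_eq)
    then show ?case
      using trans[OF R(1) S Suc] step[OF S(1) R(2)] by simp
  qed
  have zero: "P R (R[\<mu> := 0])" if R: "R \<in> cells d L" "\<mu> < d" for R \<mu>
  proof -
    have "R ! \<mu> < L" using R by (auto simp: cells_def subset_iff)
    \<comment> \<open>Shifts only go forward, so 0 is reached by wrapping around the ring.\<close>
    then show ?thesis using shifts[OF R, of "L - R ! \<mu>"] by simp
  qed
  have "P R (replicate n 0 @ drop n R)" if R: "R \<in> cells d L" and n: "n \<le> d" for R n
    using n
  proof (induction n)
    case 0
    then show ?case by (simp add: refl)
  next
    case (Suc n)
    let ?S = "replicate n 0 @ drop n R"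
    have len: "length R = d" using R by (simp add: cells_def)
    have S: "?S \<in> cells d L"
      using R L Suc(2) set_drop_subset[of n R] by (auto simp: cells_def)
    have "drop n R = R ! n # drop (Suc n) R"
      using Suc(2) len by (simp add: Cons_nth_drop_Suc)
    then have eq: "?S[n := 0] = replicate (Suc n) 0 @ drop (Suc n) R"
      by (simp add: list_update_append replicate_append_same)
    have "P R ?S" using Suc by simp
    moreover have "P ?S (?S[n := 0])" using zero[OF S] Suc(2) by simp
    ultimately show ?case
      using trans[OF R S upd[OF S L, of n]] unfolding eq by blast
  qed
  from this[of _ d] have *: "P R (replicate d 0)" if "R \<in> cells d L" for R
    using that by (simp add: cells_def)
  have "replicate d 0 \<in> cells d L" using L by (auto simp: cells_def)
  then show ?thesis
    using trans[OF R _ Q *[OF R] sym[OF *[OF Q]]] by blast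
qed

section \<open>The quartet Hamiltonian in a sector\<close>

definition broken :: "nat \<Rightarrow> nat \<Rightarrow> mode set \<Rightarrow> nat" where
  "broken d L S = card {R \<in> cells d L. \<not> (cell_modes R \<subseteq> S \<or> cell_modes R \<inter> S = {})}"

text \<open>\<open>u\<close> is the amplitude of the hop from \<open>R\<close> to \<open>R'\<close>,
  after which \<open>R'\<close> is full; the conjugate belongs to the reverse hop.\<close>

definition hop :: "complex \<Rightarrow> cell \<Rightarrow> cell \<Rightarrow> mode set \<Rightarrow> complex" where
  "hop u R R' S = u * of_bool (movable R' R S) + cnj u * of_bool (movable R R' S)"

definition hop_kernel :: "complex \<Rightarrow> cell \<Rightarrow> cell \<Rightarrow> mode set \<Rightarrow> mode set \<Rightarrow> complex" where
  "hop_kernel u R R' S T = of_bool (T = swap_cells R R' S) * hop u R R' S"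

lemma hermitian_hop_kernel: "hop_kernel u R R' T S = cnj (hop_kernel u R R' S T)"
proof -
  have "S = swap_cells R R' T \<longleftrightarrow> T = swap_cells R R' S" by auto
  moreover have "movable R' R (swap_cells R R' S) \<longleftrightarrow> movable R R' S"
    by (subst swap_cells_commute) (rule movable_swap_cells)
  ultimately show ?thesis
    by (auto simp: hop_kernel_def hop_def movable_swap_cells)
qed

lemma of_real_bool: "of_real (of_bool P) = (of_bool P :: complex)"
  by simp

text \<open>A chord of the unit circle is no longer than its arc.\<close>

lemma cmod_cis_diff_le: "cmod (cis s - cis t) \<le> \<bar>s - t\<bar>"
proof -
  have "cis s - cis t = cis t * (exp (\<i> * of_real (s - t)) - 1)"
    by (simp add: cis_conv_exp right_diff_distrib flip: exp_add)
  then have "cmod (cis s - cis t) = 2 * \<bar>sin ((s - t) / 2)\<bar>"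
    by (simp only: norm_mult norm_cis mult_1 dist_exp_i_1)
  also have "\<dots> \<le> \<bar>s - t\<bar>"
    using abs_sin_x_le_abs_x[of "(s - t) / 2"] by simp
  finally show ?thesis .
qed

locale quartet_lattice =
  fixes d L a :: nat and U J :: real and M :: nat
  assumes U: "U > 0" and J: "J > 0" and a: "a < d" and L: "2 \<le> L" and M: "0 < M" "M < L ^ d"
begin

abbreviation V :: "cell set" where "V \<equiv> cells d L"
abbreviation sh :: "nat \<Rightarrow> cell \<Rightarrow> cell" where "sh \<equiv> shift L"

definition X :: "mode set set" where
  "X = {S. S \<subseteq> modes d L \<and> card S = 4 * M}"

lemma finite_X: "finite X"
  by (rule finite_subset[of _ "Pow (modes d L)"]) (auto simp: X_def finite_modes)

lemma finite_V: "finite V"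
  using card_cells[of d L] M by (metis card.infinite not_less0)

lemma finite_bonds: "finite (bonds d L)"
  by (simp add: bonds_def finite_V)

lemma nth_less: "R \<in> V \<Longrightarrow> i < d \<Longrightarrow> R ! i < L"
  by (auto simp: cells_def subset_iff)

lemma shift_in: "R \<in> V \<Longrightarrow> sh \<mu> R \<in> V"
  using L set_update_subset_insert[of R \<mu>] by (fastforce simp: cells_def shift_def)

lemma shift_neq: "R \<in> V \<Longrightarrow> \<mu> < d \<Longrightarrow> sh \<mu> R \<noteq> R"
proof
  assume R: "R \<in> V" "\<mu> < d" and eq: "sh \<mu> R = R"
  have "R ! \<mu> < L" using R by (rule nth_less)
  moreover have "(R ! \<mu> + 1) mod L = R ! \<mu>"
    using eq R by (metis (mono_tags, lifting) cells_def mem_Collect_eq nth_list_update_eq shift_def)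
  ultimately show False
    using L by (cases "R ! \<mu> + 1 = L") auto
qed

lemma inj_shift: "inj_on (sh \<mu>) V"
proof (rule inj_onI)
  fix R Q assume RQ: "R \<in> V" "Q \<in> V" and eq: "sh \<mu> R = sh \<mu> Q"
  have len: "length R = d" "length Q = d" using RQ by (auto simp: cells_def)
  show "R = Q"
  proof (rule nth_equalityI)
    show "length R = length Q" using len by simp
    fix i assume i: "i < length R"
    have eqi: "sh \<mu> R ! i = sh \<mu> Q ! i" using eq by simp
    show "R ! i = Q ! i"
    proof (cases "i = \<mu>")
      case True
      have "R ! i < L" "Q ! i < L" using RQ i len by (auto intro: nth_less)
      moreover have "(R ! i + 1) mod L = (Q ! i + 1) mod L"
        using eqi True i len by (simp add: shift_def)
      ultimately show ?thesis
        by (cases "R ! i + 1 = L"; cases "Q ! i + 1 = L") auto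
    next
      case False
      then show ?thesis using eqi by (simp add: shift_def)
    qed
  qed
qed

lemma bij_shift: "bij_betw (sh \<mu>) V V"
  unfolding bij_betw_def using inj_shift endo_inj_surj[OF finite_V _ inj_shift] shift_in by blast

lemma swap_in_X: "R \<in> V \<Longrightarrow> R' \<in> V \<Longrightarrow> swap_cells R R' S \<in> X \<longleftrightarrow> S \<in> X"
  by (simp add: X_def swap_cells_subset_modes)

section \<open>The Hamiltonian as a kernel on the configurations of the sector\<close>

definition diag :: "mode set \<Rightarrow> real" where
  "diag S = U * real (broken d L S)
     + J / 2 * (\<Sum>(R, \<mu>)\<in>bonds d L. of_bool (movable R (sh \<mu> R) S) + of_bool (movable (sh \<mu> R) R S))"

text \<open>The argument is an arbitrary complex number and enters real-linearly, so differences and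
  derivatives of the Hamiltonian in the twist are again kernels of this form.\<close>

definition twist_kernel :: "complex \<Rightarrow> mode set \<Rightarrow> mode set \<Rightarrow> complex" where
  "twist_kernel u S T = - (J / 2) * (\<Sum>R\<in>V. hop_kernel u R (sh a R) S T)"

definition H0 :: "mode set \<Rightarrow> mode set \<Rightarrow> complex" where
  "H0 S T = of_bool (S = T) * of_real (diag S) - J / 2 * (\<Sum>(R, \<mu>)\<in>bonds d L. hop_kernel 1 R (sh \<mu> R) S T)"

text \<open>\<open>H0\<close> already contains the untwisted transfers along \<open>a\<close>, so
  only the excess of the phase over 1 is added.\<close>

definition H :: "real \<Rightarrow> mode set \<Rightarrow> mode set \<Rightarrow> complex" where
  "H \<Theta> S T = H0 S T + twist_kernel (cis (\<Theta> / L) - 1) S T"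

lemma kernel_apply_hop:
  assumes "R \<in> V" "R' \<in> V" "S \<in> X"
  shows "(\<Sum>T\<in>X. hop_kernel u R R' S T * \<psi> T) = hop u R R' S * \<psi> (swap_cells R R' S)"
proof -
  have "(\<Sum>T\<in>X. hop_kernel u R R' S T * \<psi> T) =
      (\<Sum>T\<in>X. if T = swap_cells R R' S then hop u R R' S * \<psi> (swap_cells R R' S) else 0)"
    by (intro sum.cong) (auto simp: hop_kernel_def)
  also have "\<dots> = hop u R R' S * \<psi> (swap_cells R R' S)"
    using assms finite_X by (simp add: swap_in_X)
  finally show ?thesis .
qed

lemma kernel_apply_twist:
  assumes "S \<in> X"
  shows "kernel_apply X (twist_kernel u) \<psi> S =
    - (J / 2) * (\<Sum>R\<in>V. hop u R (sh a R) S * \<psi> (swap_cells R (sh a R) S))"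
proof -
  have "kernel_apply X (twist_kernel u) \<psi> S =
    - (J / 2) * (\<Sum>R\<in>V. \<Sum>T\<in>X. hop_kernel u R (sh a R) S T * \<psi> T)"
    unfolding kernel_apply_def twist_kernel_def
    by (subst sum.swap) (simp add: sum_distrib_left sum_distrib_right algebra_simps)
  then show ?thesis
    using assms by (simp add: kernel_apply_hop shift_in cong: sum.cong)
qed

lemma kernel_apply_H0:
  assumes "S \<in> X"
  shows "kernel_apply X H0 \<psi> S = of_real (diag S) * \<psi> S
    - J / 2 * (\<Sum>(R, \<mu>)\<in>bonds d L. hop 1 R (sh \<mu> R) S * \<psi> (swap_cells R (sh \<mu> R) S))"
proof -
  have "(\<Sum>T\<in>X. (\<Sum>(R, \<mu>)\<in>bonds d L. hop_kernel 1 R (sh \<mu> R) S T) * \<psi> T) =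
    (\<Sum>T\<in>X. \<Sum>(R, \<mu>)\<in>bonds d L. hop_kernel 1 R (sh \<mu> R) S T * \<psi> T)"
    by (simp add: sum_distrib_right case_prod_unfold)
  also have "\<dots> = (\<Sum>(R, \<mu>)\<in>bonds d L. \<Sum>T\<in>X. hop_kernel 1 R (sh \<mu> R) S T * \<psi> T)"
    unfolding case_prod_unfold by (rule sum.swap)
  also have "\<dots> = (\<Sum>(R, \<mu>)\<in>bonds d L. hop 1 R (sh \<mu> R) S * \<psi> (swap_cells R (sh \<mu> R) S))"
    using assms by (intro sum.cong refl) (auto simp: kernel_apply_hop shift_in bonds_def)
  finally have off: "(\<Sum>T\<in>X. (\<Sum>(R, \<mu>)\<in>bonds d L. hop_kernel 1 R (sh \<mu> R) S T) * \<psi> T) =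
    (\<Sum>(R, \<mu>)\<in>bonds d L. hop 1 R (sh \<mu> R) S * \<psi> (swap_cells R (sh \<mu> R) S))" .
  have "(\<Sum>T\<in>X. of_bool (S = T) * of_real (diag S) * \<psi> T) =
      (\<Sum>T\<in>X. if T = S then of_real (diag S) * \<psi> S else 0)"
    by (intro sum.cong) auto
  also have "\<dots> = of_real (diag S) * \<psi> S"
    using assms finite_X by simp
  finally have on: "(\<Sum>T\<in>X. of_bool (S = T) * of_real (diag S) * \<psi> T) = of_real (diag S) * \<psi> S" .
  have "kernel_apply X H0 \<psi> S = (\<Sum>T\<in>X. of_bool (S = T) * of_real (diag S) * \<psi> T
      - J / 2 * ((\<Sum>(R, \<mu>)\<in>bonds d L. hop_kernel 1 R (sh \<mu> R) S T) * \<psi> T))"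
    unfolding kernel_apply_def H0_def by (simp only: left_diff_distrib mult.assoc)
  then show ?thesis
    unfolding sum_subtractf on sum_distrib_left[symmetric] off .
qed

lemma kernel_apply_H:
  "kernel_apply X (H \<Theta>) \<psi> S = kernel_apply X H0 \<psi> S + kernel_apply X (twist_kernel (cis (\<Theta> / L) - 1)) \<psi> S"
  by (simp add: kernel_apply_def H_def sum.distrib algebra_simps)

lemma H_untwisted_apply:
  assumes "\<psi> \<in> fock d L"
  shows "H_untwisted d L U J \<psi> S = of_real (diag S) * \<psi> S
    - J / 2 * (\<Sum>(R, \<mu>)\<in>bonds d L. hop 1 R (sh \<mu> R) S * \<psi> (swap_cells R (sh \<mu> R) S))"
proof -
  let ?c = "\<lambda>R \<mu>. (of_bool (movable R (sh \<mu> R) S) + of_bool (movable (sh \<mu> R) R S)) :: complex"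
  have "(\<Sum>R\<in>V. (id - proj_quartet R) \<psi> S) = (\<Sum>R\<in>V. of_bool (\<not> (cell_modes R \<subseteq> S \<or> cell_modes R \<inter> S = {})) * \<psi> S)"
    by (intro sum.cong) (auto simp: proj_quartet_apply)
  also have "\<dots> = of_nat (broken d L S) * \<psi> S"
    using finite_V by (simp add: broken_def sum_distrib_right[symmetric] Int_def flip: sum.inter_filter)
  finally have 1: "(\<Sum>R\<in>V. (id - proj_quartet R) \<psi> S) = of_nat (broken d L S) * \<psi> S" .
  have "(\<Sum>(R, \<mu>)\<in>bonds d L. bond_term R (sh \<mu> R) \<psi> S) =
    (\<Sum>(R, \<mu>)\<in>bonds d L. ?c R \<mu> / 2 * (\<psi> S - \<psi> (swap_cells R (sh \<mu> R) S)))"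
  proof (intro sum.cong refl, clarify)
    fix R \<mu> assume "(R, \<mu>) \<in> bonds d L"
    then have "R \<in> V" "sh \<mu> R \<in> V" "R \<noteq> sh \<mu> R"
      using shift_in shift_neq[of R \<mu>] by (auto simp: bonds_def)
    from bond_term_apply[OF this assms]
    show "bond_term R (sh \<mu> R) \<psi> S = ?c R \<mu> / 2 * (\<psi> S - \<psi> (swap_cells R (sh \<mu> R) S))" .
  qed
  also have "\<dots> = (\<Sum>(R, \<mu>)\<in>bonds d L. ?c R \<mu> * (\<psi> S / 2)
      - hop 1 R (sh \<mu> R) S * \<psi> (swap_cells R (sh \<mu> R) S) / 2)"
    by (intro sum.cong) (auto simp: hop_def field_simps)
  also have "\<dots> = (\<Sum>(R, \<mu>)\<in>bonds d L. ?c R \<mu>) * (\<psi> S / 2)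
      - (\<Sum>(R, \<mu>)\<in>bonds d L. hop 1 R (sh \<mu> R) S * \<psi> (swap_cells R (sh \<mu> R) S)) / 2"
    by (simp only: case_prod_unfold sum_subtractf sum_distrib_right[symmetric] sum_divide_distrib[symmetric])
  finally have 2: "(\<Sum>(R, \<mu>)\<in>bonds d L. bond_term R (sh \<mu> R) \<psi> S) = \<dots>" .
  have "H_untwisted d L U J \<psi> S = U * (\<Sum>R\<in>V. (id - proj_quartet R) \<psi> S)
    + J * (\<Sum>(R, \<mu>)\<in>bonds d L. bond_term R (sh \<mu> R) \<psi> S)"
    by (simp add: H_untwisted_def op_scale_def sum_operator_apply case_prod_unfold)
  then show ?thesis
    unfolding 1 2 by (simp add: diag_def case_prod_unfold of_real_bool algebra_simps)
qed

lemma transfer_apply: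
  assumes "\<psi> \<in> fock d L"
  shows "transfer d L a J \<theta> \<psi> S =
    - (J / 2) * (\<Sum>R\<in>V. hop (cis \<theta>) R (sh a R) S * \<psi> (swap_cells R (sh a R) S))"
proof -
  have "transfer d L a J \<theta> \<psi> S = - (J / 2) * (\<Sum>R\<in>V.
      cis \<theta> * quartet_create (sh a R) (quartet_annihilate R \<psi>) S
      + cis (- \<theta>) * quartet_create R (quartet_annihilate (sh a R) \<psi>) S)"
    by (simp add: transfer_def op_scale_def sum_operator_apply)
  also have "\<dots> = - (J / 2) * (\<Sum>R\<in>V. hop (cis \<theta>) R (sh a R) S * \<psi> (swap_cells R (sh a R) S))"
  proof (intro arg_cong2[where f = "(*)"] refl sum.cong)
    fix R assume R: "R \<in> V"
    then have "sh a R \<in> V" "sh a R \<noteq> R" using shift_in shift_neq a by auto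
    with R assms show "cis \<theta> * quartet_create (sh a R) (quartet_annihilate R \<psi>) S
      + cis (- \<theta>) * quartet_create R (quartet_annihilate (sh a R) \<psi>) S =
      hop (cis \<theta>) R (sh a R) S * \<psi> (swap_cells R (sh a R) S)"
      by (simp add: quartet_hop_apply[of _ d L] hop_def cis_cnj swap_cells_commute[of "sh a R" R] algebra_simps)
  qed
  finally show ?thesis .
qed

lemma H_twisted_apply:
  assumes "\<psi> \<in> fock d L"
  shows "H_twisted d L a U J \<Theta> \<psi> S = of_real (diag S) * \<psi> S
    - J / 2 * (\<Sum>(R, \<mu>)\<in>bonds d L. hop 1 R (sh \<mu> R) S * \<psi> (swap_cells R (sh \<mu> R) S))
    - J / 2 * (\<Sum>R\<in>V. hop (cis (\<Theta> / L) - 1) R (sh a R) S * \<psi> (swap_cells R (sh a R) S))"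
proof -
  have "hop (cis (\<Theta> / L) - 1) R (sh a R) S = hop (cis (\<Theta> / L)) R (sh a R) S - hop (cis 0) R (sh a R) S" for R
    by (simp add: hop_def algebra_simps)
  then show ?thesis
    by (simp add: H_twisted_def H_untwisted_apply transfer_apply assms sum_subtractf left_diff_distrib
        right_diff_distrib)
qed

lemma sector_X: "\<psi> \<in> sector d L (4 * M) \<longleftrightarrow> (\<forall>S. S \<notin> X \<longrightarrow> \<psi> S = 0)"
  by (auto simp: sector_iff X_def)

lemma H_twisted_sector:
  assumes "\<psi> \<in> sector d L (4 * M)"
  shows "H_twisted d L a U J \<Theta> \<psi> S = (if S \<in> X then kernel_apply X (H \<Theta>) \<psi> S else 0)"
proof -
  have fock: "\<psi> \<in> fock d L" using assms by (simp add: sector_def)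
  have zero: "\<psi> T = 0" if "T \<notin> X" for T using assms that by (simp add: sector_X)
  show ?thesis
  proof (cases "S \<in> X")
    case True
    then show ?thesis
      by (simp add: H_twisted_apply[OF fock] kernel_apply_H kernel_apply_H0 kernel_apply_twist)
  next
    case False
    \<comment> \<open>Swaps preserve \<open>X\<close>, so no hop leads from \<open>X\<close> to a
      configuration outside it.\<close>
    then have "\<psi> (swap_cells R R' S) = 0" if "R \<in> V" "R' \<in> V" for R R'
      using that by (intro zero) (simp add: swap_in_X)
    then have "(\<Sum>(R, \<mu>)\<in>bonds d L. hop 1 R (sh \<mu> R) S * \<psi> (swap_cells R (sh \<mu> R) S)) = 0"
      "(\<Sum>R\<in>V. hop (cis (\<Theta> / L) - 1) R (sh a R) S * \<psi> (swap_cells R (sh a R) S)) = 0"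
      using shift_in by (auto intro!: sum.neutral simp: bonds_def)
    with False zero[OF False] show ?thesis
      by (simp add: H_twisted_apply[OF fock])
  qed
qed

text \<open>The sector consists of the functions vanishing outside \<open>X\<close>, and the
  Hamiltonian preserves it. Conversely, an eigenfunction on \<open>X\<close> becomes a state after
  extension by 0.\<close>

lemma energy_level_iff:
  "energy_level (H_twisted d L a U J \<Theta>) (sector d L (4 * M)) E \<longleftrightarrow> (\<exists>\<psi>. eigen_on X (H \<Theta>) E \<psi>)"
proof
  assume "energy_level (H_twisted d L a U J \<Theta>) (sector d L (4 * M)) E"
  then obtain \<psi> where \<psi>: "\<psi> \<in> sector d L (4 * M)" "\<psi> \<noteq> (\<lambda>S. 0)"
    "\<And>S. H_twisted d L a U J \<Theta> \<psi> S = of_real E * \<psi> S"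
    by (auto simp: energy_level_def fun_eq_iff)
  have "\<exists>S\<in>X. \<psi> S \<noteq> 0" using \<psi>(1,2) unfolding sector_X by fastforce
  moreover have "kernel_apply X (H \<Theta>) \<psi> S = of_real E * \<psi> S" if "S \<in> X" for S
    using \<psi>(3)[of S] that by (simp add: H_twisted_sector[OF \<psi>(1)])
  ultimately show "\<exists>\<psi>. eigen_on X (H \<Theta>) E \<psi>"
    unfolding eigen_on_def by blast
next
  assume "\<exists>\<psi>. eigen_on X (H \<Theta>) E \<psi>"
  then obtain \<psi> where \<psi>: "eigen_on X (H \<Theta>) E \<psi>" by blast
  define \<phi> where "\<phi> S = (if S \<in> X then \<psi> S else 0)" for S
  have \<phi>: "\<phi> \<in> sector d L (4 * M)" by (simp add: sector_X \<phi>_def)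
  have "kernel_apply X (H \<Theta>) \<phi> S = kernel_apply X (H \<Theta>) \<psi> S" for S
    unfolding kernel_apply_def by (intro sum.cong) (auto simp: \<phi>_def)
  then have "H_twisted d L a U J \<Theta> \<phi> = (\<lambda>S. of_real E * \<phi> S)"
    using \<psi> by (auto simp: H_twisted_sector[OF \<phi>] eigen_on_def \<phi>_def)
  moreover have "\<phi> \<noteq> (\<lambda>S. 0)"
    using \<psi> unfolding eigen_on_def \<phi>_def fun_eq_iff by metis
  ultimately show "energy_level (H_twisted d L a U J \<Theta>) (sector d L (4 * M)) E"
    using \<phi> unfolding energy_level_def by blast
qed

lemma E0_eq: "E0 d L a U J M = (\<lambda>\<Theta>. lowest_eigenvalue X (H \<Theta>))"
  by (rule ext) (simp add: E0_def lowest_eigenvalue_def energy_level_iff)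

section \<open>Hermiticity and smooth dependence on the twist\<close>

lemma hermitian_twist: "hermitian_on X (twist_kernel u)"
  unfolding hermitian_on_def
proof (intro ballI)
  fix S T
  have "(\<Sum>R\<in>V. hop_kernel u R (sh a R) T S) = cnj (\<Sum>R\<in>V. hop_kernel u R (sh a R) S T)"
    unfolding cnj_sum by (rule sum.cong[OF refl hermitian_hop_kernel])
  then show "twist_kernel u T S = cnj (twist_kernel u S T)"
    by (simp add: twist_kernel_def)
qed

lemma hermitian_H0: "hermitian_on X H0"
  unfolding hermitian_on_def
proof (intro ballI)
  fix S T
  have "(\<Sum>(R, \<mu>)\<in>bonds d L. hop_kernel 1 R (sh \<mu> R) T S) =
      cnj (\<Sum>(R, \<mu>)\<in>bonds d L. hop_kernel 1 R (sh \<mu> R) S T)"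
    unfolding cnj_sum case_prod_unfold by (rule sum.cong[OF refl hermitian_hop_kernel])
  then show "H0 T S = cnj (H0 S T)"
    by (auto simp: H0_def)
qed

lemma hermitian_H: "hermitian_on X (H \<Theta>)"
  unfolding hermitian_on_def H_def complex_cnj_add
  using hermitian_H0 hermitian_twist[of "cis (\<Theta> / L) - 1"] unfolding hermitian_on_def
  by (intro ballI arg_cong2[where f = "(+)"]) blast+

lemma twist_kernel_has_vector_derivative:
  assumes "(u has_vector_derivative u') (at t)"
  shows "((\<lambda>t. twist_kernel (u t) S T) has_vector_derivative twist_kernel u' S T) (at t)"
  unfolding twist_kernel_def hop_kernel_def hop_def
  by (intro has_vector_derivative_mult_right has_vector_derivative_mult_left has_vector_derivative_sum
      has_vector_derivative_add has_vector_derivative_cnj assms)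

lemma twist_kernel_diff: "twist_kernel u S T - twist_kernel v S T = twist_kernel (u - v) S T"
  by (simp add: twist_kernel_def hop_kernel_def hop_def algebra_simps sum_subtractf sum.distrib)

lemma cmod_twist_kernel_le: "cmod (twist_kernel u S T) \<le> J * card V * cmod u"
proof -
  have "cmod (hop_kernel u R R' S T) \<le> 2 * cmod u" for R R'
  proof -
    have "cmod (hop u R R' S) \<le> cmod u + cmod u"
      unfolding hop_def by (rule norm_triangle_le) (auto simp: norm_mult intro!: add_mono mult_left_le)
    then show ?thesis by (auto simp: hop_kernel_def)
  qed
  then have "cmod (\<Sum>R\<in>V. hop_kernel u R (sh a R) S T) \<le> of_nat (card V) * (2 * cmod u)"
    by (intro sum_norm_bound) auto
  then have "J / 2 * cmod (\<Sum>R\<in>V. hop_kernel u R (sh a R) S T) \<le> J / 2 * (of_nat (card V) * (2 * cmod u))"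
    using J by (intro mult_left_mono) auto
  then show ?thesis
    using J by (simp add: twist_kernel_def norm_mult norm_divide)
qed

definition H' :: "real \<Rightarrow> mode set \<Rightarrow> mode set \<Rightarrow> complex" where
  "H' \<Theta> = twist_kernel (\<i> / L * cis (\<Theta> / L))"

text \<open>The coefficient is the square of \<open>\<i> / L\<close>, the second derivative of the
  phase at zero twist.\<close>

definition H'' :: "mode set \<Rightarrow> mode set \<Rightarrow> complex" where
  "H'' = twist_kernel (- 1 / (of_nat L)\<^sup>2)"

lemma cis_has_vector_derivative:
  "((\<lambda>t. cis (t / real L)) has_vector_derivative \<i> / L * cis (t / L)) (at t)"
  using L by (auto simp: has_vector_derivative_complex_iff intro!: derivative_eq_intros)

lemma deriv_H: "((\<lambda>t. H t S T) has_vector_derivative H' t S T) (at t)"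
proof -
  have "((\<lambda>t. cis (t / real L) - 1) has_vector_derivative \<i> / L * cis (t / L)) (at t)"
    using has_vector_derivative_diff[OF cis_has_vector_derivative has_vector_derivative_const[of 1]]
    by simp
  from has_vector_derivative_add[OF has_vector_derivative_const[of "H0 S T"]
      twist_kernel_has_vector_derivative[OF this]]
  show ?thesis
    unfolding H_def H'_def by simp
qed

lemma deriv_H': "((\<lambda>t. H' t S T) has_vector_derivative H'' S T) (at 0)"
proof -
  have "((\<lambda>t. \<i> / L * cis (t / real L)) has_vector_derivative \<i> / L * (\<i> / L * cis (0 / L))) (at 0)"
    by (intro has_vector_derivative_mult_right cis_has_vector_derivative)
  also have "\<i> / L * (\<i> / L * cis (0 / L)) = - 1 / (of_nat L)\<^sup>2"
    by (simp add: power2_eq_square)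
  finally show ?thesis
    unfolding H'_def H''_def by (rule twist_kernel_has_vector_derivative)
qed

lemma H_lipschitz: "cmod (H s S T - H t S T) \<le> J * card V * \<bar>s - t\<bar>"
proof -
  have "H s S T - H t S T = twist_kernel (cis (s / L) - cis (t / L)) S T"
    using twist_kernel_diff[of "cis (s / L) - 1" S T "cis (t / L) - 1"] by (simp add: H_def)
  then have "cmod (H s S T - H t S T) \<le> J * card V * cmod (cis (s / L) - cis (t / L))"
    using cmod_twist_kernel_le by simp
  also have "\<dots> \<le> J * card V * \<bar>s / L - t / L\<bar>"
    using J by (intro mult_left_mono cmod_cis_diff_le) auto
  also have "\<dots> \<le> J * card V * \<bar>s - t\<bar>"
  proof (intro mult_left_mono)
    have "\<bar>s / L - t / L\<bar> = \<bar>s - t\<bar> / L"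
      by (simp flip: diff_divide_distrib)
    also have "\<dots> \<le> \<bar>s - t\<bar> / 1"
      using L by (intro divide_left_mono) auto
    finally show "\<bar>s / L - t / L\<bar> \<le> \<bar>s - t\<bar>" by simp
  qed (use J in auto)
  finally show ?thesis .
qed

section \<open>The quadratic form at zero twist and its zeros\<close>

definition bond_difference :: "(mode set \<Rightarrow> complex) \<Rightarrow> cell \<Rightarrow> cell \<Rightarrow> mode set \<Rightarrow> complex" where
  "bond_difference \<psi> R R' S =
     (of_bool (movable R R' S) + of_bool (movable R' R S)) * (\<psi> S - \<psi> (swap_cells R R' S))"

lemma kernel_apply_H_0:
  fixes \<psi> :: "mode set \<Rightarrow> complex"
  assumes "S \<in> X"
  shows "kernel_apply X (H 0) \<psi> S = U * broken d L S * \<psi> S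
    + J / 2 * (\<Sum>(R, \<mu>)\<in>bonds d L. bond_difference \<psi> R (sh \<mu> R) S)"
proof -
  let ?c = "\<lambda>R \<mu>. (of_bool (movable R (sh \<mu> R) S) + of_bool (movable (sh \<mu> R) R S)) :: complex"
  have "H 0 = H0"
    by (intro ext) (simp add: H_def twist_kernel_def hop_kernel_def hop_def)
  have "(\<Sum>(R, \<mu>)\<in>bonds d L. bond_difference \<psi> R (sh \<mu> R) S)
    = (\<Sum>(R, \<mu>)\<in>bonds d L. ?c R \<mu> * \<psi> S - hop 1 R (sh \<mu> R) S * \<psi> (swap_cells R (sh \<mu> R) S))"
    by (intro sum.cong) (auto simp: hop_def bond_difference_def algebra_simps)
  also have "\<dots> = (\<Sum>(R, \<mu>)\<in>bonds d L. ?c R \<mu>) * \<psi> S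
    - (\<Sum>(R, \<mu>)\<in>bonds d L. hop 1 R (sh \<mu> R) S * \<psi> (swap_cells R (sh \<mu> R) S))"
    by (simp only: case_prod_unfold sum_subtractf sum_distrib_right[symmetric])
  finally have *: "(\<Sum>(R, \<mu>)\<in>bonds d L. bond_difference \<psi> R (sh \<mu> R) S) = \<dots>" .
  show ?thesis
    unfolding \<open>H 0 = H0\<close> kernel_apply_H0[OF assms] *
    by (simp add: diag_def case_prod_unfold of_real_bool algebra_simps)
qed

text \<open>Summation by parts: the swap carries the terms movable in one direction to those movable
  in the other, and each pair of configurations then completes a square.\<close>

lemma bond_form:
  assumes "R \<in> V" "R' \<in> V"
  shows "inner_on X \<psi> (bond_difference \<psi> R R') =
    of_real (\<Sum>S\<in>X. of_bool (movable R R' S) * (cmod (\<psi> S - \<psi> (swap_cells R R' S)))\<^sup>2)"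
proof -
  let ?sw = "swap_cells R R'"
  have "(\<Sum>S\<in>X. cnj (\<psi> S) * (of_bool (movable R' R S) * (\<psi> S - \<psi> (?sw S))))
    = (\<Sum>S\<in>X. cnj (\<psi> (?sw S)) * (of_bool (movable R R' S) * (\<psi> (?sw S) - \<psi> S)))"
    by (rule sum.reindex_bij_witness[of _ ?sw ?sw])
      (use assms in \<open>auto simp: swap_in_X movable_swap_cells\<close>)
  then have "inner_on X \<psi> (bond_difference \<psi> R R')
    = (\<Sum>S\<in>X. cnj (\<psi> S) * (of_bool (movable R R' S) * (\<psi> S - \<psi> (?sw S))))
      + (\<Sum>S\<in>X. cnj (\<psi> (?sw S)) * (of_bool (movable R R' S) * (\<psi> (?sw S) - \<psi> S)))"
    by (simp add: inner_on_def bond_difference_def algebra_simps sum.distrib sum_subtractf)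
  also have "\<dots> = (\<Sum>S\<in>X. of_real (of_bool (movable R R' S) * (cmod (\<psi> S - \<psi> (?sw S)))\<^sup>2))"
    unfolding sum.distrib[symmetric]
    by (intro sum.cong refl)
      (simp only: of_real_mult of_real_bool complex_norm_square complex_cnj_diff, simp add: algebra_simps)
  finally show ?thesis by simp
qed

lemma quad_form_H_0:
  "quad_form X (H 0) \<psi> = U * (\<Sum>S\<in>X. broken d L S * (cmod (\<psi> S))\<^sup>2)
    + J / 2 * (\<Sum>(R, \<mu>)\<in>bonds d L. \<Sum>S\<in>X.
        of_bool (movable R (sh \<mu> R) S) * (cmod (\<psi> S - \<psi> (swap_cells R (sh \<mu> R) S)))\<^sup>2)"
proof -
  have "inner_on X \<psi> (kernel_apply X (H 0) \<psi>) = inner_on X \<psi> (\<lambda>S. U * broken d L S * \<psi> S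
    + J / 2 * (\<Sum>(R, \<mu>)\<in>bonds d L. bond_difference \<psi> R (sh \<mu> R) S))"
    by (intro inner_on_cong refl) (rule kernel_apply_H_0)
  also have "\<dots> = inner_on X \<psi> (\<lambda>S. U * (broken d L S * \<psi> S))
    + J / 2 * inner_on X \<psi> (\<lambda>S. \<Sum>(R, \<mu>)\<in>bonds d L. bond_difference \<psi> R (sh \<mu> R) S)"
    by (simp only: inner_on_add_right inner_on_scale_right of_real_mult of_real_of_nat_eq mult.assoc)
  also have "inner_on X \<psi> (\<lambda>S. \<Sum>(R, \<mu>)\<in>bonds d L. bond_difference \<psi> R (sh \<mu> R) S) =
    (\<Sum>(R, \<mu>)\<in>bonds d L. inner_on X \<psi> (bond_difference \<psi> R (sh \<mu> R)))"
    unfolding inner_on_def case_prod_unfold sum_distrib_left by (rule sum.swap)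
  also have "\<dots> = (\<Sum>(R, \<mu>)\<in>bonds d L. of_real (\<Sum>S\<in>X.
        of_bool (movable R (sh \<mu> R) S) * (cmod (\<psi> S - \<psi> (swap_cells R (sh \<mu> R) S)))\<^sup>2))"
    by (intro sum.cong refl) (auto simp: bonds_def bond_form shift_in)
  also have "inner_on X \<psi> (\<lambda>S. U * (broken d L S * \<psi> S)) =
      of_real (U * (\<Sum>S\<in>X. broken d L S * (cmod (\<psi> S))\<^sup>2))"
    unfolding inner_on_def of_real_mult of_real_sum sum_distrib_left complex_norm_square
    by (intro sum.cong refl) simp
  finally show ?thesis
    unfolding quad_form_def by (simp add: case_prod_unfold)
qed

definition paired :: "mode set \<Rightarrow> bool" where
  "paired S \<longleftrightarrow> (\<forall>R\<in>V. cell_modes R \<subseteq> S \<or> cell_modes R \<inter> S = {})"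

definition e :: "mode set \<Rightarrow> complex" where "e S = of_bool (paired S)"

lemma broken_eq_0: "broken d L S = 0 \<longleftrightarrow> paired S"
  using finite_V by (auto simp: broken_def paired_def)

lemma paired_swap: "R \<in> V \<Longrightarrow> R' \<in> V \<Longrightarrow> paired (swap_cells R R' S) \<longleftrightarrow> paired S"
proof -
  assume RR: "R \<in> V" "R' \<in> V"
  have imp: "paired (swap_cells R R' S)" if "paired S" for S
    unfolding paired_def
  proof
    fix Q assume "Q \<in> V"
    then have "Transposition.transpose R R' Q \<in> V"
      using RR by (auto simp: Transposition.transpose_def)
    with that have "cell_modes (Transposition.transpose R R' Q) \<subseteq> S
        \<or> cell_modes (Transposition.transpose R R' Q) \<inter> S = {}"
      unfolding paired_def by blast
    then show "cell_modes Q \<subseteq> swap_cells R R' S \<or> cell_modes Q \<inter> swap_cells R R' S = {}"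
      by (simp add: cell_modes_eq mem_swap_cells)
  qed
  show ?thesis using imp[of S] imp[of "swap_cells R R' S"] by auto
qed

definition lift :: "cell set \<Rightarrow> mode set" where "lift A = A \<times> {1..4}"

lemma cell_modes_lift: "cell_modes R \<subseteq> lift A \<longleftrightarrow> R \<in> A" "cell_modes R \<inter> lift A = {} \<longleftrightarrow> R \<notin> A"
  by (simp_all add: cell_modes_eq lift_def)

lemma movable_lift: "movable R R' (lift A) \<longleftrightarrow> R \<in> A \<and> R' \<notin> A"
  by (simp add: movable_def cell_modes_lift)

lemma swap_lift: "swap_cells R R' (lift A) = lift (Transposition.transpose R R' ` A)"
  by (simp add: swap_cells_def lift_def map_prod_image)

lemma lift_in_X: "A \<subseteq> V \<Longrightarrow> card A = M \<Longrightarrow> lift A \<in> X"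
  by (auto simp: X_def lift_def modes_def card_cartesian_product)

lemma paired_lift: "paired (lift A)"
  by (auto simp: paired_def cell_modes_lift)

lemma inj_lift: "inj lift"
  unfolding lift_def by (rule injI) (auto simp: times_eq_iff)

text \<open>A paired configuration is determined by its full cells, and \<open>4 * M\<close>
  particles fill exactly \<open>M\<close> of them.\<close>

lemma paired_eq_lift: "{S \<in> X. paired S} = lift ` {A. A \<subseteq> V \<and> card A = M}"
proof (intro subset_antisym subsetI)
  fix S assume "S \<in> {S \<in> X. paired S}"
  then have S: "S \<subseteq> V \<times> {1..4}" "card S = 4 * M" "paired S" by (auto simp: X_def modes_def)
  let ?A = "{R \<in> V. cell_modes R \<subseteq> S}"
  have "S = lift ?A"
    using S(1,3) by (fastforce simp: lift_def paired_def cell_modes_def)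
  moreover have "card (lift ?A) = 4 * M"
    using S(2) calculation by metis
  then have "card ?A = M"
    by (simp add: lift_def card_cartesian_product)
  ultimately show "S \<in> lift ` {A. A \<subseteq> V \<and> card A = M}" by blast
qed (use lift_in_X paired_lift in blast)

lemma quad_form_nonneg: "0 \<le> quad_form X (H 0) \<psi>"
  unfolding quad_form_H_0 using U J by (auto intro!: add_nonneg_nonneg mult_nonneg_nonneg sum_nonneg)

lemma quad_form_eq_0:
  assumes "quad_form X (H 0) \<psi> = 0"
  shows "\<exists>z. \<forall>S\<in>X. \<psi> S = z * e S"
proof -
  let ?B = "\<Sum>S\<in>X. broken d L S * (cmod (\<psi> S))\<^sup>2"
  let ?h = "\<lambda>R \<mu> S. of_bool (movable R (sh \<mu> R) S) * (cmod (\<psi> S - \<psi> (swap_cells R (sh \<mu> R) S)))\<^sup>2"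
  let ?D = "\<Sum>(R, \<mu>)\<in>bonds d L. \<Sum>S\<in>X. ?h R \<mu> S"
  have B: "?B \<ge> 0" and D: "?D \<ge> 0" by (auto intro!: sum_nonneg)
  have "U * ?B + J / 2 * ?D = 0" using assms unfolding quad_form_H_0 .
  moreover have "U * ?B \<ge> 0" "J / 2 * ?D \<ge> 0"
    using U J B D by (auto intro!: mult_nonneg_nonneg)
  ultimately have "U * ?B = 0" "J / 2 * ?D = 0" by linarith+
  then have B0: "?B = 0" and D0: "?D = 0" using U J by auto
  have broken: "\<psi> S = 0" if "S \<in> X" "\<not> paired S" for S
  proof -
    have "broken d L S * (cmod (\<psi> S))\<^sup>2 = 0"
      using B0 finite_X that(1) by (subst (asm) sum_nonneg_eq_0_iff) auto
    then show ?thesis using that(2) by (simp add: broken_eq_0)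
  qed
  have hopping: "\<psi> (swap_cells R (sh \<mu> R) S) = \<psi> S" if "S \<in> X" "R \<in> V" "\<mu> < d" "movable R (sh \<mu> R) S" for R \<mu> S
  proof -
    have "\<forall>(R, \<mu>)\<in>bonds d L. (\<Sum>S\<in>X. ?h R \<mu> S) = 0"
      using D0 finite_bonds by (subst (asm) sum_nonneg_eq_0_iff) (auto intro!: sum_nonneg)
    then have "(\<Sum>S\<in>X. ?h R \<mu> S) = 0" using that by (auto simp: bonds_def)
    then have "?h R \<mu> S = 0"
      using finite_X that(1) by (subst (asm) sum_nonneg_eq_0_iff) auto
    then show ?thesis using that(4) by simp
  qed
  let ?f = "\<lambda>A. \<psi> (lift A)"
  have step: "swap_invariant V M ?f R (sh \<mu> R)" if R: "R \<in> V" "\<mu> < d" for R \<mu>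
    unfolding swap_invariant_def
  proof (intro allI impI)
    fix A assume A: "A \<subseteq> V" "card A = M"
    let ?R' = "sh \<mu> R"
    have R': "?R' \<in> V" using shift_in R by blast
    note X = lift_in_X[OF A]
    consider "R \<in> A" "?R' \<notin> A" | "R \<notin> A" "?R' \<in> A" | "R \<in> A \<longleftrightarrow> ?R' \<in> A" by blast
    then show "?f (Transposition.transpose R ?R' ` A) = ?f A"
    proof cases
      case 1
      then show ?thesis
        using hopping[OF X R] by (simp add: movable_lift swap_lift)
    next
      case 2
      let ?S = "swap_cells R ?R' (lift A)"
      \<comment> \<open>\<open>hopping\<close> covers only one orientation of the bond, so it is
        applied to the swapped configuration.\<close>
      have "\<psi> (swap_cells R ?R' ?S) = \<psi> ?S"
        using 2 X R R' by (intro hopping) (simp_all add: swap_in_X movable_swap_cells movable_lift)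
      then show ?thesis by (simp add: swap_lift[symmetric])
    next
      case 3
      then show ?thesis by simp
    qed
  qed
  have inv: "swap_invariant V M ?f R Q" if "R \<in> V" "Q \<in> V" for R Q
  proof (rule shift_connected[where P = "swap_invariant V M ?f"])
    show "0 < L" using L by simp
    show "swap_invariant V M ?f R Q" if "R \<in> V" "P \<in> V" "Q \<in> V"
      "swap_invariant V M ?f R P" "swap_invariant V M ?f P Q" for R P Q
      using that by (rule swap_invariant_trans)
  qed (rule that step swap_invariant_refl swap_invariant_sym; assumption?)+
  have const: "\<psi> S = \<psi> T" if "S \<in> X" "T \<in> X" "paired S" "paired T" for S T
  proof -
    have "S \<in> lift ` {A. A \<subseteq> V \<and> card A = M}" "T \<in> lift ` {A. A \<subseteq> V \<and> card A = M}"
      using that paired_eq_lift by blast+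
    then obtain A B where "S = lift A" "T = lift B" "A \<subseteq> V" "card A = M" "B \<subseteq> V" "card B = M"
      by blast
    then show ?thesis
      using swap_invariant_imp_constant[OF finite_V inv, of A B] by simp
  qed
  show ?thesis
  proof (cases "\<exists>T\<in>X. paired T")
    case True
    then obtain T where T: "T \<in> X" "paired T" by blast
    have "\<psi> S = \<psi> T * e S" if "S \<in> X" for S
      using const[OF that T(1) _ T(2)] broken[OF that] by (simp add: e_def)
    then show ?thesis by blast
  next
    case False
    then show ?thesis using broken by (auto simp: e_def)
  qed
qed

section \<open>Counting paired configurations and vanishing of the current\<close>

lemma card_V: "card V = L ^ d"
  by (rule card_cells)

lemma card_paired: "card {S \<in> X. paired S} = (L ^ d) choose M"
proof -
  have "card {S \<in> X. paired S} = card {A. A \<subseteq> V \<and> card A = M}"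
    unfolding paired_eq_lift by (rule card_image) (rule inj_on_subset[OF inj_lift], simp)
  also have "\<dots> = card V choose M"
    by (rule n_subsets[OF finite_V])
  finally show ?thesis by (simp add: card_V)
qed

lemma card_paired_movable:
  assumes "R \<in> V" "R' \<in> V" "R \<noteq> R'"
  shows "card {S \<in> X. paired S \<and> movable R R' S} = (L ^ d - 2) choose (M - 1)"
proof -
  have "{S \<in> X. paired S \<and> movable R R' S} = {S \<in> {S \<in> X. paired S}. movable R R' S}"
    by blast
  also have "\<dots> = lift ` {A. A \<subseteq> V \<and> card A = M \<and> R \<in> A \<and> R' \<notin> A}"
    unfolding paired_eq_lift using movable_lift[of R R'] by blast
  finally have "card {S \<in> X. paired S \<and> movable R R' S} = card {A. A \<subseteq> V \<and> card A = M \<and> R \<in> A \<and> R' \<notin> A}"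
    by (simp add: card_image[OF inj_on_subset[OF inj_lift subset_UNIV]])
  then show ?thesis
    using card_subsets_separating[OF finite_V assms M(1)] by (simp add: card_V)
qed

lemma e_swap: "R \<in> V \<Longrightarrow> R' \<in> V \<Longrightarrow> e (swap_cells R R' S) = e S"
  by (simp add: e_def paired_swap)

lemma e_nonzero: "\<exists>S\<in>X. e S \<noteq> 0"
proof -
  have "card {S \<in> X. paired S} > 0"
    unfolding card_paired using M by simp
  then have "{S \<in> X. paired S} \<noteq> {}" by (metis card.empty less_numeral_extra(3))
  then show ?thesis by (auto simp: e_def)
qed

lemma H_e: "S \<in> X \<Longrightarrow> kernel_apply X (H 0) e S = 0"
proof -
  assume S: "S \<in> X"
  have "(\<Sum>(R, \<mu>)\<in>bonds d L. bond_difference e R (sh \<mu> R) S) = 0"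
    by (intro sum.neutral) (auto simp: bond_difference_def bonds_def e_swap shift_in)
  moreover have "broken d L S * e S = 0"
    using broken_eq_0[of S] by (simp add: e_def)
  ultimately show ?thesis
    unfolding kernel_apply_H_0[OF S] by (simp only: of_real_mult of_real_of_nat_eq mult.assoc mult_zero_right add_0_right)
qed

lemma kernel_apply_twist_e:
  assumes "S \<in> X"
  shows "kernel_apply X (twist_kernel u) e S = - (J / 2) * (\<Sum>R\<in>V. hop u R (sh a R) S) * e S"
  unfolding kernel_apply_twist[OF assms] mult.assoc sum_distrib_right
  by (intro arg_cong2[where f = "(*)"] refl sum.cong) (simp add: e_swap shift_in)

text \<open>
  Along each ring in direction \<open>a\<close> a paired configuration has as many occupied cells followed by an
  empty one as empty cells followed by an occupied one, so it carries no current.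
\<close>

lemma H'_e: "S \<in> X \<Longrightarrow> kernel_apply X (H' 0) e S = 0"
proof (cases "paired S")
  assume S: "S \<in> X"
  case True
  let ?o = "\<lambda>R. of_bool (cell_modes R \<subseteq> S) :: complex"
  have mov: "of_bool (movable R R' S) = ?o R * (1 - ?o R')" if "R \<in> V" "R' \<in> V" for R R'
  proof -
    have "cell_modes R' \<inter> S = {} \<longleftrightarrow> \<not> cell_modes R' \<subseteq> S"
      using True that by (auto simp: paired_def cell_modes_eq)
    then show ?thesis by (simp add: movable_def)
  qed
  \<comment> \<open>The phase factor is purely imaginary, so the two hop directions enter with
    opposite signs and the products of occupations cancel, leaving a telescoping difference.\<close>
  have "(\<Sum>R\<in>V. hop (\<i> / L * cis (0 / L)) R (sh a R) S) = (\<Sum>R\<in>V. \<i> / L * (?o (sh a R) - ?o R))"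
    by (intro sum.cong refl) (simp add: hop_def mov shift_in algebra_simps)
  also have "\<dots> = \<i> / L * ((\<Sum>R\<in>V. ?o (sh a R)) - (\<Sum>R\<in>V. ?o R))"
    by (simp only: sum_subtractf sum_distrib_left[symmetric])
  also have "(\<Sum>R\<in>V. ?o (sh a R)) = (\<Sum>R\<in>V. ?o R)"
    by (rule sum.reindex_bij_betw[OF bij_shift])
  finally show ?thesis
    unfolding H'_def kernel_apply_twist_e[OF S] by simp
next
  assume S: "S \<in> X"
  case False
  then show ?thesis
    unfolding H'_def kernel_apply_twist_e[OF S] by (simp add: e_def)
qed

sublocale pert: perturbed_ground_state X H H' H'' "J * card V" e
proof
  show "hermitian_on X (H' t)" for t
    unfolding H'_def by (rule hermitian_twist)
qed (rule finite_X hermitian_H H_lipschitz deriv_H deriv_H' quad_form_nonneg quad_form_eq_0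
    e_nonzero H_e H'_e; assumption)+

section \<open>The diamagnetic term and the stiffness at finite size\<close>

lemma norm_e_sq: "(norm_on X e)\<^sup>2 = real ((L ^ d) choose M)"
proof -
  have "(norm_on X e)\<^sup>2 = (\<Sum>S\<in>X. of_bool (paired S))"
    unfolding norm_on_sq by (intro sum.cong) (auto simp: e_def)
  also have "\<dots> = real (card {S \<in> X. paired S})"
    using finite_X by (simp add: Int_def)
  finally show ?thesis by (simp add: card_paired)
qed

text \<open>Each of the \<open>L ^ d\<close> bonds along \<open>a\<close> contributes one count for
  either orientation, which cancels the 1/2 in the transfer term; the signs of that term and of
  \<open>H''\<close> cancel as well.\<close>

lemma inner_e_H''_e:
  "inner_on X e (kernel_apply X H'' e) =
    of_real (J / (real L)\<^sup>2 * real (L ^ d) * real ((L ^ d - 2) choose (M - 1)))"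
proof -
  have count: "(\<Sum>S\<in>X. of_bool (paired S) * of_bool (movable R R' S) :: complex)
      = of_nat ((L ^ d - 2) choose (M - 1))" if "R \<in> V" "R' \<in> V" "R \<noteq> R'" for R R'
  proof -
    have "(\<Sum>S\<in>X. of_bool (paired S) * of_bool (movable R R' S) :: complex)
      = of_nat (card {S \<in> X. paired S \<and> movable R R' S})"
      using finite_X by (simp add: Int_def flip: of_bool_conj)
    then show ?thesis by (simp add: card_paired_movable[OF that])
  qed
  let ?b = "of_bool :: bool \<Rightarrow> complex"
  let ?c = "of_nat ((L ^ d - 2) choose (M - 1)) :: complex"
  have "inner_on X e (kernel_apply X H'' e) = (\<Sum>S\<in>X. \<Sum>R\<in>V. (J / (2 * (real L)\<^sup>2)) *
      (?b (paired S) * ?b (movable R (sh a R) S) + ?b (paired S) * ?b (movable (sh a R) R S)))"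
    unfolding inner_on_def
  proof (intro sum.cong refl)
    fix S assume S: "S \<in> X"
    show "cnj (e S) * kernel_apply X H'' e S = (\<Sum>R\<in>V. (J / (2 * (real L)\<^sup>2)) *
      (?b (paired S) * ?b (movable R (sh a R) S) + ?b (paired S) * ?b (movable (sh a R) R S)))"
      unfolding H''_def kernel_apply_twist_e[OF S]
      by (cases "paired S") (simp_all add: e_def hop_def sum_distrib_left sum_negf[symmetric] algebra_simps add_divide_distrib)
  qed
  also have "\<dots> = (\<Sum>R\<in>V. (J / (2 * (real L)\<^sup>2)) * ((\<Sum>S\<in>X. ?b (paired S) * ?b (movable R (sh a R) S))
      + (\<Sum>S\<in>X. ?b (paired S) * ?b (movable (sh a R) R S))))"
    by (subst sum.swap) (simp only: sum_distrib_left[symmetric] sum.distrib)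
  also have "\<dots> = (\<Sum>R\<in>V. (J / (2 * (real L)\<^sup>2)) * (?c + ?c))"
  proof (intro sum.cong refl)
    fix R assume R: "R \<in> V"
    have R': "sh a R \<in> V" "sh a R \<noteq> R" using shift_in shift_neq R a by auto
    show "(J / (2 * (real L)\<^sup>2)) * ((\<Sum>S\<in>X. ?b (paired S) * ?b (movable R (sh a R) S))
      + (\<Sum>S\<in>X. ?b (paired S) * ?b (movable (sh a R) R S))) = (J / (2 * (real L)\<^sup>2)) * (?c + ?c)"
      using count[OF R R'(1) R'(2)[symmetric]] count[OF R'(1) R R'(2)] by (simp only:)
  qed
  also have "\<dots> = of_real (J / (real L)\<^sup>2 * real (L ^ d) * real ((L ^ d - 2) choose (M - 1)))"
    by (simp add: card_V)
  finally show ?thesis .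
qed

lemma E0_differentiable: "\<forall>\<^sub>F \<Theta> in nhds 0. E0 d L a U J M differentiable at \<Theta>"
  unfolding E0_eq by (rule pert.differentiable_E)

lemma deriv_E0:
  "(deriv (E0 d L a U J M) has_real_derivative
     J / (real L)\<^sup>2 * real (L ^ d) * (real M * real (L ^ d - M) / real (L ^ d * (L ^ d - 1)))) (at 0)"
proof -
  have N: "L ^ d > 1" using M by linarith
  have pos: "real ((L ^ d) choose M) > 0" using M by simp
  have "real ((L ^ d - 2) choose (M - 1)) = real M * real (L ^ d - M) / real (L ^ d * (L ^ d - 1)) * real ((L ^ d) choose M)"
  proof -
    have "x = m / k * z" if "k * x = m * z" "k \<noteq> 0" for x m z k :: real
      using that by (simp add: field_simps)
    moreover have "real (L ^ d * (L ^ d - 1)) \<noteq> 0"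
      using N L by (simp only: of_nat_eq_0_iff) simp
    ultimately show ?thesis
      using choose_minus_two[OF M] by blast
  qed
  then have "Re (inner_on X e (kernel_apply X H'' e)) / (norm_on X e)\<^sup>2 =
    J / (real L)\<^sup>2 * real (L ^ d) * (real M * real (L ^ d - M) / real (L ^ d * (L ^ d - 1)))"
    unfolding inner_e_H''_e norm_e_sq Re_complex_of_real using pos by (simp only: mult.assoc) simp
  with pert.second_derivative show ?thesis unfolding E0_eq by simp
qed

text \<open>The prefactor is L^2 / N with N = \<open>L ^ d\<close>. It cancels both the L^-2 from
  spreading the twist over the ring and the number N of bonds along it.\<close>

lemma rho4_eq:
  "rho4 d a U J L M = J * (real M * (real (L ^ d) - real M)) / (real (L ^ d) * (real (L ^ d) - 1))"
proof -
  have N: "L ^ d > 1" using M by linarith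
  have powi: "real L powi (2 - int d) = (real L)\<^sup>2 / real (L ^ d)"
    using L by (simp add: power_int_diff)
  have diffs: "real (L ^ d - M) = real (L ^ d) - real M" "real (L ^ d - 1) = real (L ^ d) - 1"
    using M N by (simp_all only: of_nat_diff less_imp_le of_nat_1)
  have "(real L)\<^sup>2 / n * (J / (real L)\<^sup>2 * n * x) = J * x" if "n \<noteq> 0" for n x :: real
    using that L by (simp add: field_simps)
  from this[of "real (L ^ d)"] show ?thesis
    unfolding rho4_def DERIV_imp_deriv[OF deriv_E0] powi of_nat_mult diffs using L by simp
qed

end

section \<open>All lattice sizes and the thermodynamic limit\<close>

text \<open>For \<open>L\<close> at most 1 there is at most one cell, which leaves no room for
  \<open>0 < M\<close> and \<open>M < L ^ d\<close>.\<close>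

lemma quartet_latticeI:
  assumes "U > 0" "J > 0" "a < d" "0 < M \<and> M < L ^ d"
  shows "quartet_lattice d L a U J M"
proof
  show "2 \<le> L"
  proof (rule ccontr)
    assume "\<not> 2 \<le> L"
    then have "L ^ d \<le> 1 ^ d" by (intro power_mono) auto
    with assms(4) show False by simp
  qed
qed (use assms in auto)

text \<open>\<open>deriv\<close> and \<open>lim\<close> return a value even where no derivative or
  limit exists; the differentiability and convergence clauses ensure that \<open>rho4\<close> and
  the last conjunct speak of genuine ones.\<close>

theorem proposition1:
  fixes d a :: nat and U J :: real
  assumes "U > 0" and "J > 0" and "a < d"
  shows
    "(\<forall>L M. 0 < M \<and> M < L ^ d \<longrightarrow>
        (\<forall>\<^sub>F \<Theta> in nhds 0. E0 d L a U J M differentiable at \<Theta>) \<and>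
        deriv (E0 d L a U J M) differentiable at 0 \<and>
        rho4 d a U J L M =
          J * (real M * (real (L ^ d) - real M)) / (real (L ^ d) * (real (L ^ d) - 1))) \<and>
     (\<forall>(L :: nat \<Rightarrow> nat) (M :: nat \<Rightarrow> nat) (\<nu> :: real).
        filterlim L at_top sequentially \<and>
        (\<forall>\<^sub>F k in sequentially. 0 < M k \<and> M k < L k ^ d) \<and>
        (\<lambda>k. real (M k) / real (L k ^ d)) \<longlonglongrightarrow> \<nu> \<longrightarrow>
          (\<lambda>k. rho4 d a U J (L k) (M k)) \<longlonglongrightarrow> J * \<nu> * (1 - \<nu>) \<and>
          (0 < \<nu> \<and> \<nu> < 1 \<longrightarrow> 0 < lim (\<lambda>k. rho4 d a U J (L k) (M k))))"
proof (intro conjI allI impI)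
  fix L M :: nat
  assume LM: "0 < M \<and> M < L ^ d"
  interpret quartet_lattice d L a U J M by (rule quartet_latticeI[OF assms LM])
  show "\<forall>\<^sub>F \<Theta> in nhds 0. E0 d L a U J M differentiable at \<Theta>"
    by (rule E0_differentiable)
  show "deriv (E0 d L a U J M) differentiable at 0"
    using deriv_E0 real_differentiable_def by blast
  show "rho4 d a U J L M = J * (real M * (real (L ^ d) - real M)) / (real (L ^ d) * (real (L ^ d) - 1))"
    by (rule rho4_eq)
next
  fix L M :: "nat \<Rightarrow> nat" and \<nu> :: real
  assume *: "filterlim L at_top sequentially \<and> (\<forall>\<^sub>F k in sequentially. 0 < M k \<and> M k < L k ^ d) \<and>
    (\<lambda>k. real (M k) / real (L k ^ d)) \<longlonglongrightarrow> \<nu>"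
  let ?x = "\<lambda>k. real (M k) / real (L k ^ d)" and ?N = "\<lambda>k. real (L k ^ d)"
  have "filterlim (\<lambda>k. real (L k)) at_top sequentially"
    using * filterlim_compose[OF filterlim_real_sequentially] by blast
  then have "filterlim ?N at_top sequentially"
    using filterlim_pow_at_top[of d "\<lambda>k. real (L k)" sequentially] assms(3) by simp
  then have "(\<lambda>k. inverse (?N k)) \<longlonglongrightarrow> 0"
    by (rule tendsto_inverse_0_at_top)
  \<comment> \<open>Numerator and denominator of the exact formula are divided by the squared number
    of cells, so that only the filling and the inverse number of cells remain.\<close>
  then have "(\<lambda>k. J * (?x k * (1 - ?x k)) / (1 - inverse (?N k))) \<longlonglongrightarrow> J * (\<nu> * (1 - \<nu>)) / (1 - 0)"
    using * by (intro tendsto_intros) auto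
  moreover have "\<forall>\<^sub>F k in sequentially. J * (?x k * (1 - ?x k)) / (1 - inverse (?N k)) = rho4 d a U J (L k) (M k)"
    using conjunct1[OF conjunct2[OF *]]
  proof eventually_elim
    case (elim k)
    then interpret quartet_lattice d "L k" a U J "M k" by (rule quartet_latticeI[OF assms])
    have "real (L k ^ d) > real 1" using elim by (subst of_nat_less_iff) linarith
    have "J * (m / n * (1 - m / n)) / (1 - inverse n) = J * (m * (n - m)) / (n * (n - 1))"
      if "n > 1" for m n :: real
      using that by (simp add: divide_simps)
    then show ?case unfolding rho4_eq using \<open>real (L k ^ d) > real 1\<close> by simp
  qed
  ultimately have lim: "(\<lambda>k. rho4 d a U J (L k) (M k)) \<longlonglongrightarrow> J * \<nu> * (1 - \<nu>)"
    by (rule Lim_transform_eventually[THEN tendsto_eq_rhs]) simp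
  then show "(\<lambda>k. rho4 d a U J (L k) (M k)) \<longlonglongrightarrow> J * \<nu> * (1 - \<nu>)" .
  assume "0 < \<nu> \<and> \<nu> < 1"
  then show "0 < lim (\<lambda>k. rho4 d a U J (L k) (M k))"
    unfolding limI[OF lim] using assms by simp
qed

end
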